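(* Let $\mathcal{D}$ be a nonempty set, with a map $\mathrm{wt}:\mathcal{D}\to\mathbb{N}_{>0}$. Define a linear map $F_{chr}^{(\mathcal{D})}:\mathcal{H}_{\mathcal{G}(\mathcal{D})}\to\mathrm{QSym}$ by $$F_{chr}^{(\mathcal{D})}(G)=\sum_{f\in\mathbb{PVC}(G)}M_{\mathrm{wt}(f^{-1}(1)),\ldots,\mathrm{wt}(f^{-1}(\max(f)))}$$ for any $\mathcal{D}$-decorated graph $G$. Then $F_{chr}^{(\mathcal{D})}$ is a Hopf algebra morphism from $(\mathcal{H}_{\mathcal{G}(\mathcal{D})},m,\Delta)$ to $(\mathrm{QSym},m,\Delta)$, equal to $\Phi_{\varepsilon'}$, the unique homogeneous Hopf algebra morphism $\Phi$ from $(\mathcal{H}_{\mathcal{G}(\mathcal{D})},m,\Delta)$ to $(\mathrm{QSym},m,\Delta)$ such that $\varepsilon'_{\mathrm{QSym}}\circ\Phi=\varepsilon'$.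
   Context: A graph is a pair $G=(V(G),E(G))$ with $V(G)$ a finite set and $E(G)$ a set of $2$-element subsets of $V(G)$; a $\mathcal{D}$-decorated graph is a graph with a map $d:V(G)\to\mathcal{D}$, considered up to decoration-preserving isomorphism. $\mathcal{H}_{\mathcal{G}(\mathcal{D})}$ is the $\mathbb{Q}$-vector space with basis the isoclasses of $\mathcal{D}$-decorated graphs, with product $m$ given by disjoint union and coproduct $\Delta(G)=\sum_{V(G)=I\sqcup J}G_{|I}\otimes G_{|J}$ (induced decorated subgraphs). It is a Hopf algebra, graded and connected for $\mathrm{wt}(G)=\sum_{x\in V(G)}\mathrm{wt}(d(x))$. The character $\varepsilon'$ of $\mathcal{H}_{\mathcal{G}(\mathcal{D})}$ sends a graph without edges to $1$ and any other graph to $0$. $\mathbb{PVC}(G)$ is the set of packed valid colorings of $G$: maps $f:V(G)\to\mathbb{N}_{>0}$ such that $f(V(G))=\{1,\ldots,k\}$ for some $k\geq0$ (with $k=\max(f)$) and $f(x)\neq f(y)$ for any edge $\{x,y\}$. For such $f$, $\mathrm{wt}(f^{-1}(i))=\sum_{x\in V(G),\,f(x)=i}\mathrm{wt}(d(x))$. $\mathrm{QSym}$ is the $\mathbb{Q}$-vector space with basis $(M_u)$ indexed by compositions $u$ (finite, possibly empty, sequences of positive integers), graded by the sum of the letters. Its product is the quasi-shuffle product, i.e. the product such that, for an infinite totally ordered alphabet $\mathbf{X}$ of commuting variables, $M_{u_1,\ldots,u_n}\mapsto\sum_{x_1<\cdots<x_n\text{ in }\mathbf{X}}x_1^{u_1}\cdots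 x_n^{u_n}$ defines an (injective) algebra morphism to formal power series. Its coproduct is $\Delta(M_w)=\sum_{uv=w}M_u\otimes M_v$. The character $\varepsilon'_{\mathrm{QSym}}$ sends $M_u$ to $1$ if $u$ has at most one letter and to $0$ otherwise. By a theorem of Aguiar, Bergeron and Sottile, for any graded connected Hopf algebra $A$ and any character $\alpha$ of $A$ there is a unique homogeneous Hopf algebra morphism $\Phi_\alpha:A\to\mathrm{QSym}$ with $\varepsilon'_{\mathrm{QSym}}\circ\Phi_\alpha=\alpha$. *)

theory Defs
  imports Complex_Main "HOL-Library.Poly_Mapping" "HOL-Library.FuncSet"
begin

section \<open>Vector spaces with a distinguished basis\<close>

text \<open>
  The rational vector space with basis \<open>'a\<close> is \<open>'a \<Rightarrow>\<^sub>0 rat\<close>; the tensor product of the spaces with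
  bases \<open>'a\<close> and \<open>'b\<close> is the space with basis \<open>'a \<times> 'b\<close>.
\<close>

definition scale :: "rat \<Rightarrow> ('a \<Rightarrow>\<^sub>0 rat) \<Rightarrow> ('a \<Rightarrow>\<^sub>0 rat)" where
  "scale c x = Poly_Mapping.map ((*) c) x"

definition basis :: "'a \<Rightarrow> ('a \<Rightarrow>\<^sub>0 rat)" where
  "basis a = Poly_Mapping.single a 1"

definition lin_ext :: "('a \<Rightarrow> ('b \<Rightarrow>\<^sub>0 rat)) \<Rightarrow> ('a \<Rightarrow>\<^sub>0 rat) \<Rightarrow> ('b \<Rightarrow>\<^sub>0 rat)" where
  "lin_ext f x = (\<Sum>a\<in>Poly_Mapping.keys x. scale (Poly_Mapping.lookup x a) (f a))"

definition form_ext :: "('a \<Rightarrow> rat) \<Rightarrow> ('a \<Rightarrow>\<^sub>0 rat) \<Rightarrow> rat" where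
  "form_ext f x = (\<Sum>a\<in>Poly_Mapping.keys x. Poly_Mapping.lookup x a * f a)"

definition tensor :: "('a \<Rightarrow>\<^sub>0 rat) \<Rightarrow> ('b \<Rightarrow>\<^sub>0 rat) \<Rightarrow> ('a \<times> 'b \<Rightarrow>\<^sub>0 rat)" where
  "tensor x y = lin_ext (\<lambda>a. lin_ext (\<lambda>b. basis (a, b)) y) x"

definition tensor_map ::
    "(('a \<Rightarrow>\<^sub>0 rat) \<Rightarrow> ('c \<Rightarrow>\<^sub>0 rat)) \<Rightarrow> (('b \<Rightarrow>\<^sub>0 rat) \<Rightarrow> ('d \<Rightarrow>\<^sub>0 rat)) \<Rightarrow>
      ('a \<times> 'b \<Rightarrow>\<^sub>0 rat) \<Rightarrow> ('c \<times> 'd \<Rightarrow>\<^sub>0 rat)" where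
  "tensor_map \<Phi> \<Psi> = lin_ext (\<lambda>(a, b). tensor (\<Phi> (basis a)) (\<Psi> (basis b)))"

lemma lookup_scale [simp]:
  "Poly_Mapping.lookup (scale c x) a = c * Poly_Mapping.lookup x a"
  by (simp add: scale_def Poly_Mapping.map.rep_eq when_def)

lemma vector_space_scale: "vector_space scale"
  by unfold_locales (auto intro!: poly_mapping_eqI simp: lookup_add algebra_simps)

lemma lin_ext_basis [simp]: "lin_ext f (basis a) = f a"
  by (auto intro!: poly_mapping_eqI simp: lin_ext_def basis_def)

lemma lin_ext_linear:
  fixes f :: "'a \<Rightarrow> ('b \<Rightarrow>\<^sub>0 rat)"
  shows "Vector_Spaces.linear scale scale (lin_ext f)"
proof -
  interpret vector_space_pair
      "scale :: rat \<Rightarrow> ('a \<Rightarrow>\<^sub>0 rat) \<Rightarrow> ('a \<Rightarrow>\<^sub>0 rat)"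
      "scale :: rat \<Rightarrow> ('b \<Rightarrow>\<^sub>0 rat) \<Rightarrow> ('b \<Rightarrow>\<^sub>0 rat)"
    by (simp add: vector_space_pair_def vector_space_scale)
  have lin_ext_sup: "lin_ext f x = (\<Sum>a\<in>A. scale (Poly_Mapping.lookup x a) (f a))"
    if "finite A" "Poly_Mapping.keys x \<subseteq> A" for x :: "'a \<Rightarrow>\<^sub>0 rat" and A
    unfolding lin_ext_def using that
    by (intro sum.mono_neutral_left) (auto simp: in_keys_iff intro!: poly_mapping_eqI)
  show ?thesis
    unfolding Vector_Spaces.linear_iff
  proof (intro conjI allI vector_space_scale)
    fix x y :: "'a \<Rightarrow>\<^sub>0 rat" and c :: rat
    let ?A = "Poly_Mapping.keys x \<union> Poly_Mapping.keys y"
    have "lin_ext f (x + y) = (\<Sum>a\<in>?A. scale (Poly_Mapping.lookup (x + y) a) (f a))"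
      by (rule lin_ext_sup) (use Poly_Mapping.keys_add[of x y] in auto)
    also have "\<dots> = (\<Sum>a\<in>?A. scale (Poly_Mapping.lookup x a) (f a)) +
        (\<Sum>a\<in>?A. scale (Poly_Mapping.lookup y a) (f a))"
      by (simp add: lookup_add vs2.scale_left_distrib sum.distrib)
    also have "\<dots> = lin_ext f x + lin_ext f y"
      by (simp add: lin_ext_sup[of ?A x] lin_ext_sup[of ?A y])
    finally show "lin_ext f (x + y) = lin_ext f x + lin_ext f y" .
    have "lin_ext f (scale c x) =
        (\<Sum>a\<in>Poly_Mapping.keys x. scale (Poly_Mapping.lookup (scale c x) a) (f a))"
      by (rule lin_ext_sup) (auto simp: in_keys_iff)
    also have "\<dots> = scale c (lin_ext f x)"
      by (simp add: lin_ext_def vs2.scale_sum_right)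
    finally show "lin_ext f (scale c x) = scale c (lin_ext f x)" .
  qed
qed

lemma lookup_lin_ext:
  "Poly_Mapping.lookup (lin_ext f x) w =
     (\<Sum>a\<in>Poly_Mapping.keys x. Poly_Mapping.lookup x a * Poly_Mapping.lookup (f a) w)"
  by (simp add: lin_ext_def lookup_sum)

lemma lookup_tensor:
  "Poly_Mapping.lookup (tensor x y) (a, b) = Poly_Mapping.lookup x a * Poly_Mapping.lookup y b"
proof -
  have "Poly_Mapping.lookup (lin_ext (\<lambda>b'. basis (a', b')) y) (a, b) =
      (if a' = a then Poly_Mapping.lookup y b else 0)" for a'
    by (auto simp: lookup_lin_ext basis_def lookup_single when_def in_keys_iff if_distrib
        sum.delta cong: if_cong)
  note * = this
  show ?thesis
    unfolding tensor_def lookup_lin_ext[of _ x] *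
    by (auto simp: in_keys_iff if_distrib sum.delta cong: if_cong)
qed

lemma keys_tensor: "Poly_Mapping.keys (tensor x y) = Poly_Mapping.keys x \<times> Poly_Mapping.keys y"
  by (auto simp: in_keys_iff lookup_tensor)


section \<open>Graded Hopf algebras given on a basis\<close>

text \<open>
  The record gives the structure maps on basis elements; they are extended (bi)linearly.
  \<open>degr\<close> is the degree of a basis element.
\<close>

record 'b hopf_data =
  mult1 :: "'b \<Rightarrow> 'b \<Rightarrow> ('b \<Rightarrow>\<^sub>0 rat)"
  unit1 :: "'b \<Rightarrow>\<^sub>0 rat"
  comult1 :: "'b \<Rightarrow> ('b \<times> 'b \<Rightarrow>\<^sub>0 rat)"
  counit1 :: "'b \<Rightarrow> rat"
  degr :: "'b \<Rightarrow> nat"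

definition hmult :: "'b hopf_data \<Rightarrow> ('b \<Rightarrow>\<^sub>0 rat) \<Rightarrow> ('b \<Rightarrow>\<^sub>0 rat) \<Rightarrow> ('b \<Rightarrow>\<^sub>0 rat)" where
  "hmult A x y = lin_ext (\<lambda>(a, b). mult1 A a b) (tensor x y)"

definition hcomult :: "'b hopf_data \<Rightarrow> ('b \<Rightarrow>\<^sub>0 rat) \<Rightarrow> ('b \<times> 'b \<Rightarrow>\<^sub>0 rat)" where
  "hcomult A = lin_ext (comult1 A)"

definition hcounit :: "'b hopf_data \<Rightarrow> ('b \<Rightarrow>\<^sub>0 rat) \<Rightarrow> rat" where
  "hcounit A = form_ext (counit1 A)"

definition homogeneous_part :: "'b hopf_data \<Rightarrow> nat \<Rightarrow> ('b \<Rightarrow>\<^sub>0 rat) set" where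
  "homogeneous_part A n = {x. \<forall>a\<in>Poly_Mapping.keys x. degr A a = n}"

text \<open>
  A bialgebra morphism between Hopf algebras automatically commutes with the antipodes, so, as
  usual, the antipode is not mentioned.
\<close>

definition hopf_morphism ::
    "'a hopf_data \<Rightarrow> 'b hopf_data \<Rightarrow> (('a \<Rightarrow>\<^sub>0 rat) \<Rightarrow> ('b \<Rightarrow>\<^sub>0 rat)) \<Rightarrow> bool" where
  "hopf_morphism A B \<Phi> \<longleftrightarrow>
     Vector_Spaces.linear scale scale \<Phi> \<and>
     (\<forall>x y. \<Phi> (hmult A x y) = hmult B (\<Phi> x) (\<Phi> y)) \<and>
     \<Phi> (unit1 A) = unit1 B \<and>
     (\<forall>x. hcomult B (\<Phi> x) = tensor_map \<Phi> \<Phi> (hcomult A x)) \<and>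
     (\<forall>x. hcounit B (\<Phi> x) = hcounit A x)"

definition homogeneous_map ::
    "'a hopf_data \<Rightarrow> 'b hopf_data \<Rightarrow> (('a \<Rightarrow>\<^sub>0 rat) \<Rightarrow> ('b \<Rightarrow>\<^sub>0 rat)) \<Rightarrow> bool" where
  "homogeneous_map A B \<Phi> \<longleftrightarrow>
     (\<forall>n. \<Phi> ` homogeneous_part A n \<subseteq> homogeneous_part B n)"


section \<open>Decorated graphs\<close>

text \<open>
  Only isoclasses of finite graphs matter, so vertices may be taken to be natural numbers. The
  values of the decoration outside the vertex set are irrelevant and ignored by isomorphisms.
\<close>

typedef 'd dgraph =
    "{(V :: nat set, E :: nat set set, d :: nat \<Rightarrow> 'd).
        finite V \<and> E \<subseteq> {e. e \<subseteq> V \<and> card e = 2}}"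
  by (rule exI[of _ "({}, {}, undefined)"]) auto

setup_lifting type_definition_dgraph

lift_definition verts :: "'d dgraph \<Rightarrow> nat set" is "\<lambda>(V, E, d). V" .

lift_definition edges :: "'d dgraph \<Rightarrow> nat set set" is "\<lambda>(V, E, d). E" .

lift_definition deco :: "'d dgraph \<Rightarrow> nat \<Rightarrow> 'd" is "\<lambda>(V, E, d). d" .

lemma finite_verts [simp]: "finite (verts G)"
  by transfer auto

lemma edge_subset: "e \<in> edges G \<Longrightarrow> e \<subseteq> verts G"
  by transfer auto

lemma edge_card: "e \<in> edges G \<Longrightarrow> card e = 2"
  by transfer auto

lift_definition empty_dgraph :: "'d dgraph" is "({}, {}, \<lambda>_. undefined)"
  by auto

lift_definition induced :: "'d dgraph \<Rightarrow> nat set \<Rightarrow> 'd dgraph" is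
  "\<lambda>(V, E, d) I. (V \<inter> I, {e \<in> E. e \<subseteq> I}, d)"
  by auto

lemma card_image_double:
  "card ((\<lambda>x::nat. 2 * x) ` e) = card e" "card ((\<lambda>x::nat. Suc (2 * x)) ` e) = card e"
  by (auto intro!: card_image simp: inj_on_def)

text \<open>The vertex sets are made disjoint by moving them to the even and to the odd numbers.\<close>

lift_definition disj_union :: "'d dgraph \<Rightarrow> 'd dgraph \<Rightarrow> 'd dgraph" is
  "\<lambda>(V, E, d) (V', E', d').
     ((\<lambda>x. 2 * x) ` V \<union> (\<lambda>x. Suc (2 * x)) ` V',
      (\<lambda>e. (\<lambda>x. 2 * x) ` e) ` E \<union> (\<lambda>e. (\<lambda>x. Suc (2 * x)) ` e) ` E',
      \<lambda>x. if even x then d (x div 2) else d' (x div 2))"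
  by (clarsimp, safe; (blast | (drule (1) subsetD, simp add: card_image_double)))

definition dgraph_iso_by :: "(nat \<Rightarrow> nat) \<Rightarrow> 'd dgraph \<Rightarrow> 'd dgraph \<Rightarrow> bool" where
  "dgraph_iso_by \<phi> G H \<longleftrightarrow>
     bij_betw \<phi> (verts G) (verts H) \<and>
     (\<forall>x\<in>verts G. \<forall>y\<in>verts G. {x, y} \<in> edges G \<longleftrightarrow> {\<phi> x, \<phi> y} \<in> edges H) \<and>
     (\<forall>x\<in>verts G. deco H (\<phi> x) = deco G x)"

definition dgraph_iso :: "'d dgraph \<Rightarrow> 'd dgraph \<Rightarrow> bool" where
  "dgraph_iso G H \<longleftrightarrow> (\<exists>\<phi>. dgraph_iso_by \<phi> G H)"

definition weight :: "('d \<Rightarrow> nat) \<Rightarrow> 'd dgraph \<Rightarrow> nat" where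
  "weight wt G = (\<Sum>x\<in>verts G. wt (deco G x))"


section \<open>Packed valid colorings\<close>

text \<open>
  Extensional functions make a coloring determined by its values on the vertices. The largest
  color is 0 for the empty graph.
\<close>

definition max_color :: "'d dgraph \<Rightarrow> (nat \<Rightarrow> nat) \<Rightarrow> nat" where
  "max_color G f = Max (insert 0 (f ` verts G))"

definition PVC :: "'d dgraph \<Rightarrow> (nat \<Rightarrow> nat) set" where
  "PVC G = {f \<in> verts G \<rightarrow>\<^sub>E {0<..}. f ` verts G = {1..max_color G f} \<and>
     (\<forall>x y. {x, y} \<in> edges G \<longrightarrow> f x \<noteq> f y)}"

definition color_weight :: "('d \<Rightarrow> nat) \<Rightarrow> 'd dgraph \<Rightarrow> (nat \<Rightarrow> nat) \<Rightarrow> nat \<Rightarrow> nat" where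
  "color_weight wt G f i = (\<Sum>x\<in>{x \<in> verts G. f x = i}. wt (deco G x))"

definition color_word :: "('d \<Rightarrow> nat) \<Rightarrow> 'd dgraph \<Rightarrow> (nat \<Rightarrow> nat) \<Rightarrow> nat list" where
  "color_word wt G f = map (color_weight wt G f) [1..<Suc (max_color G f)]"

lemma finite_PVC: "finite (PVC G)"
proof (rule finite_subset)
  show "PVC G \<subseteq> verts G \<rightarrow>\<^sub>E {1..card (verts G)}"
  proof
    fix f assume f: "f \<in> PVC G"
    then have im: "f ` verts G = {1..max_color G f}" and ext: "f \<in> extensional (verts G)"
      by (auto simp: PVC_def PiE_def)
    have "max_color G f = card (f ` verts G)"
      using im by simp
    then have "max_color G f \<le> card (verts G)"
      by (simp add: card_image_le)
    with im have "f ` verts G \<subseteq> {1..card (verts G)}"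
      by simp
    with ext show "f \<in> verts G \<rightarrow>\<^sub>E {1..card (verts G)}"
      by (simp add: PiE_def image_subset_iff_funcset)
  qed
qed (simp add: finite_PiE)

lemma color_word_pos:
  assumes "\<And>d. 0 < wt d" "f \<in> PVC G"
  shows "0 \<notin> set (color_word wt G f)"
proof
  assume "0 \<in> set (color_word wt G f)"
  then have "0 \<in> color_weight wt G f ` {1..max_color G f}"
    by (simp only: color_word_def set_map set_upt atLeastLessThanSuc_atLeastAtMost)
  then obtain i where i: "i \<in> {1..max_color G f}" "color_weight wt G f i = 0"
    by (metis imageE)
  then have "i \<in> f ` verts G"
    using assms(2) by (simp only: PVC_def mem_Collect_eq)
  then obtain x where "x \<in> verts G" "f x = i"
    by (metis imageE)
  with i(2) assms(1)[of "deco G x"] show False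
    by (auto simp: color_weight_def)
qed


section \<open>Quasi-symmetric functions\<close>

typedef composition = "{u :: nat list. 0 \<notin> set u}"
  by (rule exI[of _ "[]"]) auto

setup_lifting type_definition_composition

definition M :: "nat list \<Rightarrow> (composition \<Rightarrow>\<^sub>0 rat)" where
  "M u = basis (Abs_composition u)"

text \<open>The quasi-shuffles of two words, listed with multiplicity.\<close>

fun qshuffle :: "nat list \<Rightarrow> nat list \<Rightarrow> nat list list" where
  "qshuffle [] v = [v]"
| "qshuffle u [] = [u]"
| "qshuffle (a # u) (b # v) =
     map ((#) a) (qshuffle u (b # v)) @
     map ((#) b) (qshuffle (a # u) v) @
     map ((#) (a + b)) (qshuffle u v)"

definition QSym :: "composition hopf_data" where
  "QSym = \<lparr>
     mult1 = (\<lambda>u v. \<Sum>w\<leftarrow>qshuffle (Rep_composition u) (Rep_composition v). M w),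
     unit1 = M [],
     comult1 = (\<lambda>w. \<Sum>i\<le>length (Rep_composition w).
        tensor (M (take i (Rep_composition w))) (M (drop i (Rep_composition w)))),
     counit1 = (\<lambda>u. if Rep_composition u = [] then 1 else 0),
     degr = (\<lambda>u. sum_list (Rep_composition u))\<rparr>"

text \<open>
  The realization of quasi-symmetric functions as power series in commuting variables indexed by a
  linear order: \<open>exponents m\<close> are the exponents of the monomial \<open>m\<close>, variables in increasing order,
  and \<open>realization p m\<close> is the coefficient of \<open>m\<close> in the power series realizing \<open>p\<close>. The lemmas
  \<open>realization_hmult\<close> and \<open>inj_realization\<close> characterize the product.
\<close>

definition exponents :: "('x::linorder \<Rightarrow>\<^sub>0 nat) \<Rightarrow> nat list" where
  "exponents m = map (Poly_Mapping.lookup m) (sorted_list_of_set (Poly_Mapping.keys m))"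

definition realization :: "(composition \<Rightarrow>\<^sub>0 rat) \<Rightarrow> ('x::linorder \<Rightarrow>\<^sub>0 nat) \<Rightarrow> rat" where
  "realization p m = Poly_Mapping.lookup p (Abs_composition (exponents m))"

lemma exponents_pos: "0 \<notin> set (exponents m)"
  by (auto simp: exponents_def in_keys_iff)

lemma realization_M:
  assumes "0 \<notin> set u"
  shows "realization (M u) m = (if exponents m = u then 1 else 0)"
  using assms exponents_pos[of m]
  by (auto simp: realization_def M_def basis_def lookup_single Abs_composition_inject when_def)

lemma exponents_0 [simp]: "exponents 0 = []"
  by (simp add: exponents_def)

lemma exponents_eq_Nil [simp]: "exponents m = [] \<longleftrightarrow> m = 0"
  by (simp add: exponents_def)

lemma exponents_add_single:
  assumes "\<And>x. x \<in> Poly_Mapping.keys m \<Longrightarrow> k < x"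
  shows "exponents (Poly_Mapping.single k i + m) = (if i = 0 then exponents m else i # exponents m)"
proof (cases "i = 0")
  case False
  have k: "k \<notin> Poly_Mapping.keys m"
    using assms by blast
  have "Poly_Mapping.keys (Poly_Mapping.single k i + m) = insert k (Poly_Mapping.keys m)"
    using False by (auto simp: in_keys_iff lookup_add lookup_single when_def split: if_splits)
  moreover have "sorted_list_of_set (insert k (Poly_Mapping.keys m)) =
      k # sorted_list_of_set (Poly_Mapping.keys m)"
    using k assms by (simp add: insort_is_Cons less_imp_le)
  moreover have "Poly_Mapping.lookup (Poly_Mapping.single k i + m) x = Poly_Mapping.lookup m x"
    if "x \<in> Poly_Mapping.keys m" for x
    using k that by (auto simp: lookup_add lookup_single when_def)
  moreover have "Poly_Mapping.lookup (Poly_Mapping.single k i + m) k = i"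
    using k by (simp add: lookup_add lookup_single in_keys_iff)
  ultimately show ?thesis
    using False by (simp add: exponents_def)
qed simp

definition factorizations :: "('x \<Rightarrow>\<^sub>0 nat) \<Rightarrow> (('x \<Rightarrow>\<^sub>0 nat) \<times> ('x \<Rightarrow>\<^sub>0 nat)) set" where
  "factorizations m = {(m1, m2). m1 + m2 = m}"

lemma factorizations_keys:
  assumes "(m1, m2) \<in> factorizations m"
  shows "Poly_Mapping.keys m1 \<subseteq> Poly_Mapping.keys m" "Poly_Mapping.keys m2 \<subseteq> Poly_Mapping.keys m"
  using assms by (auto simp: factorizations_def in_keys_iff lookup_add)

lemma factorizations_0: "factorizations 0 = {(0, 0)}"
proof -
  have "m1 = 0 \<and> m2 = 0" if "(m1, m2) \<in> factorizations 0" for m1 m2 :: "'a \<Rightarrow>\<^sub>0 nat"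
    using factorizations_keys[OF that] by (simp only: keys_zero subset_empty keys_eq_empty)
  moreover have "(0, 0) \<in> factorizations (0 :: 'a \<Rightarrow>\<^sub>0 nat)"
    by (simp add: factorizations_def)
  ultimately show ?thesis by fast
qed

lemma bij_betw_factorizations:
  fixes m :: "'x \<Rightarrow>\<^sub>0 nat"
  assumes "k \<notin> Poly_Mapping.keys m"
  shows "bij_betw
    (\<lambda>((i, j), (m1, m2)). (Poly_Mapping.single k i + m1, Poly_Mapping.single k j + m2))
    ({(i, j). i + j = a} \<times> factorizations m) (factorizations (Poly_Mapping.single k a + m))"
    (is "bij_betw ?f ?A ?B")
proof (rule bij_betw_byWitness)
  let ?g = "\<lambda>(m1, m2). ((Poly_Mapping.lookup m1 k, Poly_Mapping.lookup m2 k),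
    (Poly_Mapping.update k 0 m1, Poly_Mapping.update k 0 m2))"
  have a: "Poly_Mapping.lookup m1 k = 0" "Poly_Mapping.lookup m2 k = 0"
    if "(m1, m2) \<in> factorizations m" for m1 m2
    using factorizations_keys[OF that] assms by (auto simp: in_keys_iff)
  have z: "Poly_Mapping.update k 0 (Poly_Mapping.single k i + m1) = m1"
    if "Poly_Mapping.lookup m1 k = 0" for i and m1 :: "'x \<Rightarrow>\<^sub>0 nat"
    using that by (intro poly_mapping_eqI) (auto simp: lookup_update lookup_add lookup_single when_def)
  have s: "Poly_Mapping.single k (Poly_Mapping.lookup m1 k) + Poly_Mapping.update k 0 m1 = m1"
    for m1 :: "'x \<Rightarrow>\<^sub>0 nat"
    by (intro poly_mapping_eqI) (simp add: lookup_update lookup_add lookup_single when_def)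
  show "\<forall>x\<in>?A. ?g (?f x) = x"
    by (auto simp: z a lookup_add lookup_single)
  show "\<forall>x\<in>?B. ?f (?g x) = x"
    by (auto simp: s)
  show "?f ` ?A \<subseteq> ?B"
    by (auto simp: factorizations_def single_add algebra_simps)
  show "?g ` ?B \<subseteq> ?A"
  proof (clarsimp simp: factorizations_def)
    fix m1 m2 :: "'x \<Rightarrow>\<^sub>0 nat"
    assume eq: "m1 + m2 = Poly_Mapping.single k a + m"
    have "Poly_Mapping.lookup m1 x + Poly_Mapping.lookup m2 x =
        (if x = k then a else Poly_Mapping.lookup m x)" for x
      using arg_cong[OF eq, of "\<lambda>p. Poly_Mapping.lookup p x"] assms
      by (auto simp: lookup_add lookup_single when_def in_keys_iff split: if_splits)
    then show "Poly_Mapping.lookup m1 k + Poly_Mapping.lookup m2 k = a \<and>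
        Poly_Mapping.update k 0 m1 + Poly_Mapping.update k 0 m2 = m"
      using assms by (auto intro!: poly_mapping_eqI simp: lookup_update lookup_add in_keys_iff)
  qed
qed

lemma finite_nat_pairs: "finite {(i, j). i + j = (a :: nat)}"
  by (rule finite_subset[of _ "{..a} \<times> {..a}"]) auto

lemma monomial_induct [case_names zero add]:
  fixes m :: "'x::linorder \<Rightarrow>\<^sub>0 nat"
  assumes "P 0"
    and "\<And>k a m. P m \<Longrightarrow> 0 < a \<Longrightarrow> (\<And>x. x \<in> Poly_Mapping.keys m \<Longrightarrow> k < x) \<Longrightarrow>
      P (Poly_Mapping.single k a + m)"
  shows "P m"
proof (induction "card (Poly_Mapping.keys m)" arbitrary: m)
  case 0
  then show ?case using assms(1) by simp
next
  case (Suc n)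
  let ?k = "Min (Poly_Mapping.keys m)" and ?a = "Poly_Mapping.lookup m (Min (Poly_Mapping.keys m))"
  let ?m = "Poly_Mapping.update ?k 0 m"
  have ne: "Poly_Mapping.keys m \<noteq> {}"
    using Suc.hyps(2) by auto
  then have k: "?k \<in> Poly_Mapping.keys m"
    by (intro Min_in) auto
  have keys: "Poly_Mapping.keys ?m = Poly_Mapping.keys m - {?k}"
    by (auto simp: in_keys_iff lookup_update split: if_splits)
  have "P ?m"
    using Suc.hyps k by (intro Suc.hyps(1)) (simp add: keys)
  moreover have "0 < ?a"
    using k by (simp add: in_keys_iff)
  moreover have "?k < x" if "x \<in> Poly_Mapping.keys ?m" for x
    using that unfolding keys by (auto simp: less_le)
  ultimately have "P (Poly_Mapping.single ?k ?a + ?m)"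
    by (rule assms(2))
  moreover have "Poly_Mapping.single ?k ?a + ?m = m"
    by (intro poly_mapping_eqI) (simp add: lookup_update lookup_add lookup_single when_def)
  ultimately show ?case by simp
qed

lemma finite_factorizations:
  fixes m :: "'x::linorder \<Rightarrow>\<^sub>0 nat"
  shows "finite (factorizations m)"
proof (induction m rule: monomial_induct)
  case (add k a m)
  then have "k \<notin> Poly_Mapping.keys m" by blast
  from bij_betw_finite[OF bij_betw_factorizations[OF this, of a]] show ?case
    using add.IH finite_nat_pairs by auto
qed (simp add: factorizations_0)

lemma count_list_map_Cons:
  "count_list (map ((#) a) xs) w = (case w of [] \<Rightarrow> 0 | b # w' \<Rightarrow> if a = b then count_list xs w' else 0)"
  by (induction xs) (auto split: list.splits)

lemma card_factorizations:
  fixes m :: "'x::linorder \<Rightarrow>\<^sub>0 nat"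
  assumes "0 \<notin> set u" "0 \<notin> set v"
  shows "card {(m1, m2) \<in> factorizations m. exponents m1 = u \<and> exponents m2 = v} =
    count_list (qshuffle u v) (exponents m)"
  using assms
proof (induction m arbitrary: u v rule: monomial_induct)
  case zero
  have "{(m1, m2) \<in> factorizations (0 :: 'x \<Rightarrow>\<^sub>0 nat). exponents m1 = u \<and> exponents m2 = v} =
      (if u = [] \<and> v = [] then {(0, 0)} else {})"
    by (auto simp: factorizations_0)
  moreover have "count_list (qshuffle u v) [] = (if u = [] \<and> v = [] then 1 else 0)"
    by (cases "(u, v)" rule: qshuffle.cases) (auto simp: count_list_map_Cons)
  ultimately show ?case by simp
next
  case (add k a m)
  let ?N = "\<lambda>u v. {(m1, m2) \<in> factorizations m. exponents m1 = u \<and> exponents m2 = v}"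
  let ?c = "\<lambda>i w. if i = 0 then w else i # w"
  let ?f = "\<lambda>((i, j), (m1, m2)). (Poly_Mapping.single k i + m1, Poly_Mapping.single k j + m2)"
  let ?S = "{((i, j), (m1, m2)). i + j = a \<and> (m1, m2) \<in> factorizations m \<and>
    ?c i (exponents m1) = u \<and> ?c j (exponents m2) = v}"
  have k: "k \<notin> Poly_Mapping.keys m" using add.hyps by blast
  have exp: "exponents (Poly_Mapping.single k i + m1) = ?c i (exponents m1)"
      "exponents (Poly_Mapping.single k i + m2) = ?c i (exponents m2)"
    if "(m1, m2) \<in> factorizations m" for i m1 m2
    using factorizations_keys[OF that] add.hyps(2) by (blast intro: exponents_add_single)+
  have bij: "bij_betw ?f ({(i, j). i + j = a} \<times> factorizations m)
      (factorizations (Poly_Mapping.single k a + m))"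
    by (rule bij_betw_factorizations[OF k])
  have "bij_betw ?f ?S {(m1, m2) \<in> factorizations (Poly_Mapping.single k a + m).
      exponents m1 = u \<and> exponents m2 = v}"
  proof (rule bij_betw_subset[OF bij])
    show "?S \<subseteq> {(i, j). i + j = a} \<times> factorizations m" by auto
    show "?f ` ?S = {(m1, m2) \<in> factorizations (Poly_Mapping.single k a + m).
        exponents m1 = u \<and> exponents m2 = v}" (is "_ = ?R")
    proof (intro equalityI subsetI)
      fix p assume "p \<in> ?f ` ?S"
      then obtain q where q: "q \<in> ?S" "p = ?f q" by blast
      then have "p \<in> factorizations (Poly_Mapping.single k a + m)"
        using bij_betwE[OF bij] by blast
      then show "p \<in> ?R"
        using q exp by (cases q) auto
    next
      fix p assume p: "p \<in> ?R"
      then obtain q where "q \<in> {(i, j). i + j = a} \<times> factorizations m" "p = ?f q"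
        using bij_betw_imp_surj_on[OF bij] by blast
      then show "p \<in> ?f ` ?S"
        using p exp by (cases q, intro image_eqI[of _ _ q]) auto
    qed
  qed
  then have "card {(m1, m2) \<in> factorizations (Poly_Mapping.single k a + m).
      exponents m1 = u \<and> exponents m2 = v} = card ?S"
    by (simp add: bij_betw_same_card)
  also have "\<dots> = count_list (qshuffle u v) (a # exponents m)"
  proof (cases "(u, v)" rule: qshuffle.cases)
    case (1 v')
    have "?S = (\<lambda>p. ((0, a), p)) ` (case v of [] \<Rightarrow> {} | c # v' \<Rightarrow> if c = a then ?N [] v' else {})"
      using 1 add.hyps(1) by (auto split: list.splits if_splits)
    then have "card ?S = (case v of [] \<Rightarrow> 0 | c # v' \<Rightarrow> if c = a then card (?N [] v') else 0)"
      by (auto simp: card_image inj_on_def split: list.splits)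
    then show ?thesis
      using 1 add.IH[of "[]"] add.prems by (auto split: list.splits)
  next
    case (2 b u')
    have "?S = (\<lambda>p. ((a, 0), p)) ` (if b = a then ?N u' [] else {})"
      using 2 add.hyps(1) by (auto split: if_splits)
    then have "card ?S = (if b = a then card (?N u' []) else 0)"
      by (auto simp: card_image inj_on_def)
    moreover have "qshuffle u' [] = [u']" by (cases u') auto
    ultimately show ?thesis
      using 2 add.IH[of u' "[]"] add.prems by auto
  next
    case (3 b u' c v')
    let ?S1 = "(\<lambda>p. ((a, 0::nat), p)) ` (if b = a then ?N u' v else {})"
    let ?S2 = "(\<lambda>p. ((0::nat, a), p)) ` (if c = a then ?N u v' else {})"
    let ?S3 = "(\<lambda>p. ((b, c), p)) ` (if b + c = a then ?N u' v' else {})"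
    have bc: "0 < b" "0 < c" using 3 add.prems by auto
    have "0 \<notin> set u'" "0 \<notin> set v'" using 3 add.prems by auto
    then have IH: "card (?N u' v) = count_list (qshuffle u' v) (exponents m)"
        "card (?N u v') = count_list (qshuffle u v') (exponents m)"
        "card (?N u' v') = count_list (qshuffle u' v') (exponents m)"
      using add.IH add.prems by blast+
    have fin: "finite (?N u v)" for u v
      by (rule finite_subset[OF _ finite_factorizations[of m]]) auto
    have "?S = ?S1 \<union> (?S2 \<union> ?S3)"
      using 3 add.hyps(1) bc by (auto split: if_splits)
    moreover have "?S1 \<inter> (?S2 \<union> ?S3) = {}" "?S2 \<inter> ?S3 = {}"
      using add.hyps(1) bc by (auto split: if_splits)
    ultimately have "card ?S = card ?S1 + (card ?S2 + card ?S3)"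
      using fin by (simp add: card_Un_disjoint)
    also have "\<dots> = (if b = a then card (?N u' v) else 0) + ((if c = a then card (?N u v') else 0) +
        (if b + c = a then card (?N u' v') else 0))"
      by (simp add: card_image inj_on_def)
    also have "\<dots> = (if b = a then count_list (qshuffle u' v) (exponents m) else 0) +
        ((if c = a then count_list (qshuffle u v') (exponents m) else 0) +
         (if b + c = a then count_list (qshuffle u' v') (exponents m) else 0))"
      unfolding IH ..
    also have "\<dots> = count_list (qshuffle u v) (a # exponents m)"
      using 3 by (simp add: count_list_map_Cons)
    finally show ?thesis .
  qed
  also have "a # exponents m = exponents (Poly_Mapping.single k a + m)"
    using add.hyps by (simp add: exponents_add_single)
  finally show ?case .
qed

lemma qshuffle_pos:
  "w \<in> set (qshuffle u v) \<Longrightarrow> 0 \<notin> set u \<Longrightarrow> 0 \<notin> set v \<Longrightarrow> 0 \<notin> set w"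
  by (induction u v arbitrary: w rule: qshuffle.induct) auto

lemma lookup_sum_M:
  assumes "\<And>w. w \<in> set ws \<Longrightarrow> 0 \<notin> set w" "0 \<notin> set w"
  shows "Poly_Mapping.lookup (\<Sum>w\<leftarrow>ws. M w) (Abs_composition w) = of_nat (count_list ws w)"
  using assms
  by (induction ws)
    (auto simp: lookup_add M_def basis_def lookup_single Abs_composition_inject when_def)

lemma realization_hmult:
  fixes m :: "'x::linorder \<Rightarrow>\<^sub>0 nat"
  shows "realization (hmult QSym p q) m =
    (\<Sum>(m1, m2)\<in>factorizations m. realization p m1 * realization q m2)"
proof -
  let ?K = "Poly_Mapping.keys p \<times> Poly_Mapping.keys q"
  let ?c = "\<lambda>u v. Poly_Mapping.lookup p u * Poly_Mapping.lookup q v"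
  let ?e = "\<lambda>m. Abs_composition (exponents m)"
  have e: "?e m1 = u \<longleftrightarrow> exponents m1 = Rep_composition u" for m1 :: "'x \<Rightarrow>\<^sub>0 nat" and u
    using exponents_pos[of m1] Abs_composition_inverse[of "exponents m1"] Rep_composition_inverse[of u]
    by auto
  have pos: "0 \<notin> set (Rep_composition u)" for u
    using Rep_composition[of u] by simp
  have "realization (hmult QSym p q) m = (\<Sum>(u, v)\<in>?K. ?c u v *
      of_nat (count_list (qshuffle (Rep_composition u) (Rep_composition v)) (exponents m)))"
    unfolding realization_def hmult_def lookup_lin_ext keys_tensor
    by (intro sum.cong refl)
      (auto simp: lookup_tensor QSym_def lookup_sum_M[OF qshuffle_pos exponents_pos] pos)
  also have "\<dots> = (\<Sum>(u, v)\<in>?K. \<Sum>(m1, m2)\<in>factorizations m.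
      if ?e m1 = u \<and> ?e m2 = v then ?c u v else 0)"
  proof (intro sum.cong refl, clarsimp simp del: mult_eq_0_iff)
    fix u v
    have "(\<Sum>(m1, m2)\<in>factorizations m. if ?e m1 = u \<and> ?e m2 = v then ?c u v else 0) =
        (\<Sum>x\<in>{(m1, m2) \<in> factorizations m.
            exponents m1 = Rep_composition u \<and> exponents m2 = Rep_composition v}. ?c u v)"
      by (intro sum.mono_neutral_cong_right finite_factorizations) (auto simp: e split: if_splits)
    then show "?c u v *
        of_nat (count_list (qshuffle (Rep_composition u) (Rep_composition v)) (exponents m)) =
        (\<Sum>(m1, m2)\<in>factorizations m. if ?e m1 = u \<and> ?e m2 = v then ?c u v else 0)"
      by (simp add: card_factorizations[OF pos pos])
  qed
  also have "\<dots> = (\<Sum>(m1, m2)\<in>factorizations m. \<Sum>(u, v)\<in>?K.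
      if ?e m1 = u \<and> ?e m2 = v then ?c u v else 0)"
    unfolding split_def by (rule sum.swap)
  also have "\<dots> = (\<Sum>(m1, m2)\<in>factorizations m. realization p m1 * realization q m2)"
  proof (intro sum.cong refl, clarsimp)
    fix m1 m2 :: "'x \<Rightarrow>\<^sub>0 nat"
    have "(\<Sum>(u, v)\<in>?K. if ?e m1 = u \<and> ?e m2 = v then ?c u v else 0) =
        (\<Sum>x\<in>?K. if x = (?e m1, ?e m2) then realization p m1 * realization q m2 else 0)"
      by (intro sum.cong) (auto simp: realization_def split: if_splits)
    also have "\<dots> = realization p m1 * realization q m2"
      by (auto simp: realization_def in_keys_iff)
    finally show "(\<Sum>(u, v)\<in>?K. if ?e m1 = u \<and> ?e m2 = v then ?c u v else 0) =
        realization p m1 * realization q m2" .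
  qed
  finally show ?thesis .
qed

lemma ex_exponents:
  fixes u :: "nat list"
  assumes "infinite (UNIV :: 'x::linorder set)" "0 \<notin> set u"
  shows "\<exists>m :: 'x \<Rightarrow>\<^sub>0 nat. exponents m = u"
proof -
  obtain X :: "'x set" where X: "finite X" "card X = length u"
    using infinite_arbitrarily_large[OF assms(1)] by blast
  let ?xs = "sorted_list_of_set X"
  have len: "length ?xs = length u" and dist: "distinct ?xs" and set: "set ?xs = X"
    using X by auto
  define m where "m = Poly_Mapping.Abs_poly_mapping (\<lambda>x. case map_of (zip ?xs u) x of Some n \<Rightarrow> n | None \<Rightarrow> 0)"
  have fin: "finite {x. (case map_of (zip ?xs u) x of Some n \<Rightarrow> n | None \<Rightarrow> 0) \<noteq> 0}"
    by (rule finite_subset[OF _ X(1)])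
      (auto split: option.splits dest!: map_of_SomeD set_zip_leftD simp: set)
  have look: "Poly_Mapping.lookup m x = (case map_of (zip ?xs u) x of Some n \<Rightarrow> n | None \<Rightarrow> 0)" for x
    unfolding m_def using fin by (simp add: Abs_poly_mapping_inverse)
  have nth: "Poly_Mapping.lookup m (?xs ! i) = u ! i" if "i < length u" for i
    using that len dist by (simp add: look map_of_zip_nth)
  have "Poly_Mapping.keys m = X"
  proof (intro equalityI subsetI)
    fix x assume "x \<in> Poly_Mapping.keys m"
    then show "x \<in> X"
      by (auto simp: in_keys_iff look set split: option.splits dest!: map_of_SomeD set_zip_leftD)
  next
    fix x assume "x \<in> X"
    then obtain i where "i < length u" "x = ?xs ! i"
      using set len by (metis in_set_conv_nth)
    then show "x \<in> Poly_Mapping.keys m"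
      using nth[of i] assms(2) by (metis in_keys_iff nth_mem)
  qed
  then have "exponents m = u"
    using nth len by (auto simp: exponents_def intro!: nth_equalityI)
  then show ?thesis ..
qed

lemma inj_realization:
  assumes "infinite (UNIV :: 'x::linorder set)"
  shows "inj (realization :: _ \<Rightarrow> ('x \<Rightarrow>\<^sub>0 nat) \<Rightarrow> rat)"
proof (rule injI, rule poly_mapping_eqI)
  fix p q :: "composition \<Rightarrow>\<^sub>0 rat" and u
  assume eq: "(realization p :: ('x \<Rightarrow>\<^sub>0 nat) \<Rightarrow> rat) = realization q"
  obtain m :: "'x \<Rightarrow>\<^sub>0 nat" where "exponents m = Rep_composition u"
    using ex_exponents[OF assms] Rep_composition[of u] by auto
  then show "Poly_Mapping.lookup p u = Poly_Mapping.lookup q u"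
    using fun_cong[OF eq, of m] by (simp add: realization_def Rep_composition_inverse)
qed

definition eps'_QSym :: "(composition \<Rightarrow>\<^sub>0 rat) \<Rightarrow> rat" where
  "eps'_QSym = form_ext (\<lambda>u. if length (Rep_composition u) \<le> 1 then 1 else 0)"

definition is_ABS_morphism ::
    "'a hopf_data \<Rightarrow> (('a \<Rightarrow>\<^sub>0 rat) \<Rightarrow> rat) \<Rightarrow> (('a \<Rightarrow>\<^sub>0 rat) \<Rightarrow> (composition \<Rightarrow>\<^sub>0 rat)) \<Rightarrow> bool" where
  "is_ABS_morphism A \<alpha> \<Phi> \<longleftrightarrow>
     hopf_morphism A QSym \<Phi> \<and> homogeneous_map A QSym \<Phi> \<and> eps'_QSym \<circ> \<Phi> = \<alpha>"

definition ABS_morphism ::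
    "'a hopf_data \<Rightarrow> (('a \<Rightarrow>\<^sub>0 rat) \<Rightarrow> rat) \<Rightarrow> ('a \<Rightarrow>\<^sub>0 rat) \<Rightarrow> (composition \<Rightarrow>\<^sub>0 rat)" where
  "ABS_morphism A \<alpha> = (THE \<Phi>. is_ABS_morphism A \<alpha> \<Phi>)"


section \<open>The Hopf algebra of decorated graphs\<close>

lemma dgraph_iso_refl: "dgraph_iso_by id G G"
  by (auto simp: dgraph_iso_by_def)

lemma dgraph_iso_inv:
  assumes "dgraph_iso_by \<phi> G H"
  shows "dgraph_iso_by (the_inv_into (verts G) \<phi>) H G"
proof -
  let ?\<psi> = "the_inv_into (verts G) \<phi>"
  have b: "bij_betw \<phi> (verts G) (verts H)"
    using assms by (simp add: dgraph_iso_by_def)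
  have p: "?\<psi> x \<in> verts G" "\<phi> (?\<psi> x) = x" if "x \<in> verts H" for x
    using b that by (auto simp: bij_betw_def the_inv_into_into f_the_inv_into_f)
  show ?thesis
    using assms p bij_betw_the_inv_into[OF b] unfolding dgraph_iso_by_def by metis
qed

lemma dgraph_iso_trans:
  assumes "dgraph_iso_by \<phi> G H" "dgraph_iso_by \<psi> H K"
  shows "dgraph_iso_by (\<psi> \<circ> \<phi>) G K"
  using assms unfolding dgraph_iso_by_def
  by (auto simp: bij_betw_trans bij_betw_apply)

quotient_type 'd graph_class = "'d dgraph" / dgraph_iso
  morphisms rep_class iso_class
proof (rule equivpI)
  show "reflp (dgraph_iso :: 'd dgraph \<Rightarrow> _)"
    by (auto simp: reflp_def dgraph_iso_def intro: dgraph_iso_refl)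
  show "symp (dgraph_iso :: 'd dgraph \<Rightarrow> _)"
    by (auto simp: symp_def dgraph_iso_def intro: dgraph_iso_inv)
  show "transp (dgraph_iso :: 'd dgraph \<Rightarrow> _)"
    by (auto simp: transp_def dgraph_iso_def intro: dgraph_iso_trans)
qed

lemma edge_image_iff:
  assumes "dgraph_iso_by \<phi> G H" "e \<subseteq> verts G"
  shows "\<phi> ` e \<in> edges H \<longleftrightarrow> e \<in> edges G"
proof -
  have inj: "inj_on \<phi> e"
    using assms unfolding dgraph_iso_by_def bij_betw_def by (blast intro: inj_on_subset)
  show ?thesis
  proof (cases "card e = 2")
    case True
    then obtain x y where "e = {x, y}"
      by (auto simp: card_2_iff)
    then show ?thesis
      using assms by (auto simp: dgraph_iso_by_def)
  next
    case False
    then show ?thesis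
      using edge_card[of e G] edge_card[of "\<phi> ` e" H] card_image[OF inj] by auto
  qed
qed

lemma verts_induced [simp]: "verts (induced G I) = verts G \<inter> I"
  by transfer auto

lemma edges_induced [simp]: "edges (induced G I) = {e \<in> edges G. e \<subseteq> I}"
  by transfer auto

lemma deco_induced [simp]: "deco (induced G I) = deco G"
  by transfer auto

lemma verts_disj_union [simp]:
  "verts (disj_union G H) = (\<lambda>x. 2 * x) ` verts G \<union> (\<lambda>x. Suc (2 * x)) ` verts H"
  by transfer auto

lemma edges_disj_union:
  "edges (disj_union G H) =
     (\<lambda>e. (\<lambda>x. 2 * x) ` e) ` edges G \<union> (\<lambda>e. (\<lambda>x. Suc (2 * x)) ` e) ` edges H"
  by transfer auto

lemma deco_disj_union [simp]:
  "deco (disj_union G H) x = (if even x then deco G (x div 2) else deco H (x div 2))"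
  by transfer auto

lemma induced_iso:
  assumes "dgraph_iso_by \<phi> G H" "I \<subseteq> verts G"
  shows "dgraph_iso_by \<phi> (induced G I) (induced H (\<phi> ` I))"
proof -
  have b: "bij_betw \<phi> (verts G) (verts H)"
    using assms by (simp add: dgraph_iso_by_def)
  have "bij_betw \<phi> (verts G \<inter> I) (verts H \<inter> \<phi> ` I)"
    using b assms(2) by (auto simp: bij_betw_def inj_on_def)
  with assms show ?thesis
    unfolding dgraph_iso_by_def by auto
qed

lemma doubleton_image_iff:
  fixes \<phi> :: "nat \<Rightarrow> nat"
  assumes "inj \<phi>"
  shows "{\<phi> x, \<phi> y} \<in> (\<lambda>e. \<phi> ` e) ` E \<longleftrightarrow> {x, y} \<in> E"
proof
  assume "{\<phi> x, \<phi> y} \<in> (\<lambda>e. \<phi> ` e) ` E"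
  then obtain e where "e \<in> E" "\<phi> ` {x, y} = \<phi> ` e" by auto
  then show "{x, y} \<in> E"
    using assms by (metis inj_image_eq_iff)
next
  assume "{x, y} \<in> E"
  then show "{\<phi> x, \<phi> y} \<in> (\<lambda>e. \<phi> ` e) ` E"
    by (metis image_empty image_eqI image_insert)
qed

lemma doubleton_not_image:
  assumes "u \<notin> range \<phi>"
  shows "{u, v} \<notin> (\<lambda>e. \<phi> ` e) ` E" "{v, u} \<notin> (\<lambda>e. \<phi> ` e) ` E"
  using assms by (auto; blast)+

lemma doubleton_edges_disj_union:
  "{2 * x, 2 * y} \<in> edges (disj_union G H) \<longleftrightarrow> {x, y} \<in> edges G"
  "{Suc (2 * x), Suc (2 * y)} \<in> edges (disj_union G H) \<longleftrightarrow> {x, y} \<in> edges H"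
  "{2 * x, Suc (2 * y)} \<notin> edges (disj_union G H)"
  "{Suc (2 * x), 2 * y} \<notin> edges (disj_union G H)"
proof -
  have inj: "inj (\<lambda>x::nat. 2 * x)" "inj (\<lambda>x::nat. Suc (2 * x))"
    by (auto simp: inj_def)
  have ran: "Suc (2 * z) \<notin> range (\<lambda>x::nat. 2 * x)" "2 * z \<notin> range (\<lambda>x::nat. Suc (2 * x))" for z
    by (auto, presburger+)
  note [simp] = inj[THEN doubleton_image_iff] ran[THEN doubleton_not_image(1)]
    ran[THEN doubleton_not_image(2)]
  show "{2 * x, 2 * y} \<in> edges (disj_union G H) \<longleftrightarrow> {x, y} \<in> edges G"
    "{Suc (2 * x), Suc (2 * y)} \<in> edges (disj_union G H) \<longleftrightarrow> {x, y} \<in> edges H"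
    "{2 * x, Suc (2 * y)} \<notin> edges (disj_union G H)"
    "{Suc (2 * x), 2 * y} \<notin> edges (disj_union G H)"
    unfolding edges_disj_union Un_iff by simp_all
qed

lemma disj_union_iso:
  assumes "dgraph_iso_by \<phi> G G'" "dgraph_iso_by \<psi> H H'"
  shows "dgraph_iso_by (\<lambda>x. if even x then 2 * \<phi> (x div 2) else Suc (2 * \<psi> (x div 2)))
    (disj_union G H) (disj_union G' H')" (is "dgraph_iso_by ?\<chi> _ _")
proof -
  have b: "bij_betw \<phi> (verts G) (verts G')" "bij_betw \<psi> (verts H) (verts H')"
    using assms by (auto simp: dgraph_iso_by_def)
  have bij: "bij_betw ?\<chi> (verts (disj_union G H)) (verts (disj_union G' H'))"
    unfolding bij_betw_def
  proof
    show "inj_on ?\<chi> (verts (disj_union G H))"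
    proof (rule inj_onI)
      fix x y
      assume "x \<in> verts (disj_union G H)" "y \<in> verts (disj_union G H)" and eq: "?\<chi> x = ?\<chi> y"
      moreover have "even x = even y"
        using arg_cong[OF eq, of even] by (simp split: if_splits)
      ultimately show "x = y"
        using b unfolding verts_disj_union
        by (elim UnE imageE) (auto simp: bij_betw_def dest: inj_onD)
    qed
    show "?\<chi> ` verts (disj_union G H) = verts (disj_union G' H')"
    proof -
      have "?\<chi> ` verts (disj_union G H) =
          (\<lambda>x. 2 * x) ` \<phi> ` verts G \<union> (\<lambda>x. Suc (2 * x)) ` \<psi> ` verts H"
        unfolding verts_disj_union image_Un image_image by simp
      also have "\<dots> = verts (disj_union G' H')"
        using b by (simp add: bij_betw_def)
      finally show ?thesis .
    qed
  qed
  show ?thesis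
    unfolding dgraph_iso_by_def
  proof (intro conjI ballI)
    show "bij_betw ?\<chi> (verts (disj_union G H)) (verts (disj_union G' H'))"
      by (rule bij)
  next
    fix x y assume "x \<in> verts (disj_union G H)" "y \<in> verts (disj_union G H)"
    then show "{x, y} \<in> edges (disj_union G H) \<longleftrightarrow> {?\<chi> x, ?\<chi> y} \<in> edges (disj_union G' H')"
      using assms unfolding dgraph_iso_by_def verts_disj_union
      by (elim UnE imageE)
        (simp_all add: doubleton_edges_disj_union)
  next
    fix x assume "x \<in> verts (disj_union G H)"
    then show "deco (disj_union G' H') (?\<chi> x) = deco (disj_union G H) x"
      using assms unfolding dgraph_iso_by_def by auto
  qed
qed

lift_definition class_union :: "'d graph_class \<Rightarrow> 'd graph_class \<Rightarrow> 'd graph_class" is disj_union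
  unfolding dgraph_iso_def by (blast intro: disj_union_iso)

lift_definition class_edgeless :: "'d graph_class \<Rightarrow> bool" is "\<lambda>G. edges G = {}"
proof -
  have "edges H = {}" if "edges G = {}" "dgraph_iso_by \<phi> G H" for G H :: "'d dgraph" and \<phi>
    using that edge_subset[of _ H] edge_image_iff[OF that(2)]
    unfolding dgraph_iso_by_def bij_betw_def
    by (metis (no_types, lifting) all_not_in_conv subset_image_iff)
  then show "(edges G = {}) = (edges H = {})" if "dgraph_iso G H" for G H :: "'d dgraph"
    using that dgraph_iso_inv unfolding dgraph_iso_def by blast
qed

lift_definition class_weight :: "('d \<Rightarrow> nat) \<Rightarrow> 'd graph_class \<Rightarrow> nat" is weight
proof -
  fix wt :: "'d \<Rightarrow> nat" and G H :: "'d dgraph"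
  assume "dgraph_iso G H"
  then obtain \<phi> where \<phi>: "dgraph_iso_by \<phi> G H"
    by (auto simp: dgraph_iso_def)
  then have "(\<Sum>x\<in>verts G. wt (deco H (\<phi> x))) = weight wt H"
    unfolding weight_def dgraph_iso_by_def
    by (intro sum.reindex_bij_betw[of \<phi> _ _ "\<lambda>x. wt (deco H x)"]) simp
  with \<phi> show "weight wt G = weight wt H"
    by (simp add: weight_def dgraph_iso_by_def)
qed

lift_definition class_comult :: "'d graph_class \<Rightarrow> ('d graph_class \<times> 'd graph_class \<Rightarrow>\<^sub>0 rat)" is
  "\<lambda>G. \<Sum>I\<in>Pow (verts G). basis (iso_class (induced G I), iso_class (induced G (verts G - I)))"
proof -
  fix G H :: "'d dgraph"
  assume "dgraph_iso G H"
  then obtain \<phi> where \<phi>: "dgraph_iso_by \<phi> G H"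
    by (auto simp: dgraph_iso_def)
  then have b: "bij_betw \<phi> (verts G) (verts H)"
    by (simp add: dgraph_iso_by_def)
  have *: "iso_class (induced H (\<phi> ` I)) = iso_class (induced G I)" if "I \<subseteq> verts G" for I
    using induced_iso[OF \<phi> that] by (metis dgraph_iso_def graph_class.abs_eq_iff)
  have **: "verts H - \<phi> ` I = \<phi> ` (verts G - I)" if "I \<subseteq> verts G" for I
    using b that by (simp add: bij_betw_def inj_on_image_set_diff[of \<phi> "verts G"])
  show "(\<Sum>I\<in>Pow (verts G). basis (iso_class (induced G I), iso_class (induced G (verts G - I)))) =
      (\<Sum>I\<in>Pow (verts H). basis (iso_class (induced H I), iso_class (induced H (verts H - I))))"
    by (subst sum.reindex_bij_betw[OF bij_betw_Pow[OF b], symmetric])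
      (auto intro!: sum.cong simp: * **)
qed

definition graph_hopf :: "('d \<Rightarrow> nat) \<Rightarrow> 'd graph_class hopf_data" where
  "graph_hopf wt = \<lparr>
     mult1 = (\<lambda>G H. basis (class_union G H)),
     unit1 = basis (iso_class empty_dgraph),
     comult1 = class_comult,
     counit1 = (\<lambda>G. if G = iso_class empty_dgraph then 1 else 0),
     degr = class_weight wt\<rparr>"

definition eps'_graph :: "('d graph_class \<Rightarrow>\<^sub>0 rat) \<Rightarrow> rat" where
  "eps'_graph = form_ext (\<lambda>G. if class_edgeless G then 1 else 0)"

lemma PVC_pullback:
  assumes \<phi>: "dgraph_iso_by \<phi> G H" and f: "f \<in> PVC H"
  defines "g \<equiv> restrict (f \<circ> \<phi>) (verts G)"
  shows "g \<in> PVC G" "color_word wt G g = color_word wt H f"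
proof -
  have b: "bij_betw \<phi> (verts G) (verts H)"
    using \<phi> by (simp add: dgraph_iso_by_def)
  have im: "g ` verts G = f ` verts H"
    using b by (force simp: g_def bij_betw_def)
  then have mc: "max_color G g = max_color H f"
    by (simp add: max_color_def)
  have ed: "g x \<noteq> g y" if "{x, y} \<in> edges G" for x y
  proof -
    have xy: "x \<in> verts G" "y \<in> verts G"
      using edge_subset[OF that] by auto
    then have "{\<phi> x, \<phi> y} \<in> edges H"
      using \<phi> that by (auto simp: dgraph_iso_by_def)
    then show ?thesis
      using f xy by (auto simp: PVC_def g_def)
  qed
  have "g \<in> verts G \<rightarrow>\<^sub>E {0<..}"
    using f bij_betw_apply[OF b] by (auto simp: PVC_def g_def)
  then show "g \<in> PVC G"
    using f ed im mc by (simp add: PVC_def)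
  have "color_weight wt G g i = color_weight wt H f i" for i
  proof -
    have "bij_betw \<phi> {x \<in> verts G. g x = i} {x \<in> verts H. f x = i}"
      using b by (auto simp: bij_betw_def g_def inj_on_def)
    then have "(\<Sum>x\<in>{x \<in> verts G. g x = i}. wt (deco H (\<phi> x))) = color_weight wt H f i"
      unfolding color_weight_def by (rule sum.reindex_bij_betw)
    then show ?thesis
      using \<phi> by (simp add: color_weight_def dgraph_iso_by_def)
  qed
  then show "color_word wt G g = color_word wt H f"
    by (simp add: color_word_def mc)
qed

lift_definition class_chr :: "('d \<Rightarrow> nat) \<Rightarrow> 'd graph_class \<Rightarrow> (composition \<Rightarrow>\<^sub>0 rat)" is
  "\<lambda>wt G. \<Sum>f\<in>PVC G. M (color_word wt G f)"
proof -
  fix wt :: "'d \<Rightarrow> nat" and G H :: "'d dgraph"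
  assume "dgraph_iso G H"
  then obtain \<phi> where \<phi>: "dgraph_iso_by \<phi> G H"
    by (auto simp: dgraph_iso_def)
  define \<psi> where "\<psi> = the_inv_into (verts G) \<phi>"
  have \<psi>: "dgraph_iso_by \<psi> H G"
    using dgraph_iso_inv[OF \<phi>] by (simp add: \<psi>_def)
  have b: "bij_betw \<phi> (verts G) (verts H)" "bij_betw \<psi> (verts H) (verts G)"
    using \<phi> \<psi> by (auto simp: dgraph_iso_by_def)
  have inv: "\<psi> (\<phi> x) = x" if "x \<in> verts G" for x
    using that b by (simp add: \<psi>_def bij_betw_def the_inv_into_f_f)
  have inv': "\<phi> (\<psi> x) = x" if "x \<in> verts H" for x
    using that b by (simp add: \<psi>_def bij_betw_def f_the_inv_into_f)
  have ext: "f \<in> extensional (verts K)" if "f \<in> PVC K" for f and K :: "'d dgraph"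
    using that by (auto simp: PVC_def PiE_def)
  show "(\<Sum>f\<in>PVC G. M (color_word wt G f)) = (\<Sum>f\<in>PVC H. M (color_word wt H f))"
  proof (rule sum.reindex_bij_witness
      [of _ "\<lambda>f. restrict (f \<circ> \<phi>) (verts G)" "\<lambda>f. restrict (f \<circ> \<psi>) (verts H)"])
    fix f assume f: "f \<in> PVC G"
    show "restrict (restrict (f \<circ> \<psi>) (verts H) \<circ> \<phi>) (verts G) = f"
      using ext[OF f] by (intro extensionalityI[of _ "verts G"]) (auto simp: inv bij_betw_apply[OF b(1)])
  next
    fix f assume f: "f \<in> PVC H"
    show "restrict (restrict (f \<circ> \<phi>) (verts G) \<circ> \<psi>) (verts H) = f"
      using ext[OF f] by (intro extensionalityI[of _ "verts H"]) (auto simp: inv' bij_betw_apply[OF b(2)])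
  qed (simp_all add: PVC_pullback[OF \<phi>] PVC_pullback[OF \<psi>])
qed

definition F_chr :: "('d \<Rightarrow> nat) \<Rightarrow> ('d graph_class \<Rightarrow>\<^sub>0 rat) \<Rightarrow> (composition \<Rightarrow>\<^sub>0 rat)" where
  "F_chr wt = lin_ext (class_chr wt)"

lemma F_chr_graph:
  "F_chr wt (basis (iso_class G)) = (\<Sum>f\<in>PVC G. M (color_word wt G f))"
  by (simp add: F_chr_def class_chr.abs_eq)

end

theory Submission
  imports Defs
begin

text \<open>
  Why the theorem holds. All structure maps are (bi)linear, so everything is checked on single
  graphs.

  The product becomes transparent in power series. Replacing the color classes of a packed coloring
  of \<open>G\<close> by an increasing choice of variables yields every proper coloring of \<open>G\<close> by variables
  exactly once, so the chromatic quasi-symmetric function of \<open>G\<close> is the generating series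
  \<open>\<Sum>f. \<Prod>v. x\<^bsub>f v\<^esub> ^ wt (d v)\<close> over all proper colorings \<open>f\<close> (\<open>realization_class_chr\<close>). A proper
  coloring of a disjoint union is a pair of proper colorings, whence the generating series
  multiply; since realization is injective and turns the quasi-shuffle product into the product of
  series, \<open>class_chr_disj_union\<close> follows.

  For the coproduct, deconcatenating the word of a packed coloring \<open>f\<close> after \<open>i\<close> letters amounts to
  cutting the vertex set into the vertices of color at most \<open>i\<close> and the others. Both parts inherit a
  packed coloring, and conversely any two packed colorings of complementary induced subgraphs can be
  glued by shifting the second (\<open>cut_coloring\<close>, \<open>glue_colorings\<close>, \<open>sum_cuts_eq_sum_pairs\<close>).

  The character \<open>\<epsilon>'\<close> only sees the packed colorings with at most one color, and the constant coloring
  is valid exactly for graphs without edges.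

  Uniqueness does not depend on graphs (\<open>ABS_morphism_unique\<close>). The coefficient of \<open>M []\<close> in an image
  is given by the counit; that of \<open>M [n]\<close> is given by homogeneity and the character, because \<open>[n]\<close> is
  the only word with at most one letter of degree \<open>n > 0\<close>; that of \<open>M (n # w)\<close> is the coefficient of
  \<open>M [n] \<otimes> M w\<close> in the coproduct of the image, which compatibility with coproducts reduces to shorter
  words.
\<close>

section \<open>Linear maps and the distinguished basis\<close>

lemma linear_eq_on_basis:
  assumes f: "Vector_Spaces.linear scale s f" and g: "Vector_Spaces.linear scale s g"
    and eq: "\<And>a. f (basis a) = g (basis a)"
  shows "f x = g x"
proof (induction x rule: update_induct)
  case const
  have "(0 :: 'a \<Rightarrow>\<^sub>0 rat) = scale 0 (basis undefined)"
    by (rule poly_mapping_eqI) simp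
  then show ?case
    using f g eq unfolding Vector_Spaces.linear_iff by metis
next
  case (update x a c)
  have "Poly_Mapping.update a c x = scale c (basis a) + x"
    using update(1)
    by (auto intro!: poly_mapping_eqI
        simp: lookup_update lookup_add basis_def lookup_single when_def in_keys_iff)
  then show ?case
    using f g eq update unfolding Vector_Spaces.linear_iff by simp
qed

lemma vector_space_rat: "vector_space ((*) :: rat \<Rightarrow> rat \<Rightarrow> rat)"
  by unfold_locales (auto simp: algebra_simps)

lemma linear_composition:
  assumes "Vector_Spaces.linear s1 s2 f" "Vector_Spaces.linear s2 s3 g"
  shows "Vector_Spaces.linear s1 s3 (\<lambda>x. g (f x))"
  using assms unfolding Vector_Spaces.linear_iff by simp

lemma linear_map_sum:
  assumes "Vector_Spaces.linear s1 s2 f"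
  shows "f (\<Sum>i\<in>A. x i) = (\<Sum>i\<in>A. f (x i))"
proof -
  have add: "f (x + y) = f x + f y" for x y
    using assms unfolding Vector_Spaces.linear_iff by simp
  from add[of 0 0] have zero: "f 0 = 0" by simp
  show ?thesis
    by (induction A rule: infinite_finite_induct) (simp_all add: zero add)
qed

lemma form_ext_basis [simp]: "form_ext f (basis a) = f a"
  by (simp add: form_ext_def basis_def)

text \<open>
  Scalars are the space with the one-element basis \<open>()\<close>, so linearity of forms is a case of
  linearity of \<open>lin_ext\<close>.
\<close>

lemma form_ext_linear: "Vector_Spaces.linear scale (*) (form_ext f)"
proof -
  have eq: "form_ext f x = Poly_Mapping.lookup (lin_ext (\<lambda>a. Poly_Mapping.single () (f a)) x) ()" for x
    by (simp add: form_ext_def lookup_lin_ext)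
  show ?thesis
    unfolding eq[abs_def]
    using lin_ext_linear[of "\<lambda>a. Poly_Mapping.single () (f a)"] vector_space_rat
    unfolding Vector_Spaces.linear_iff
    by (simp add: lookup_add)
qed

lemma linear_tensor_left: "Vector_Spaces.linear scale scale (\<lambda>x. tensor x y)"
  and linear_tensor_right: "Vector_Spaces.linear scale scale (tensor x)"
  unfolding Vector_Spaces.linear_iff
  by (auto intro!: poly_mapping_eqI vector_space_scale
      simp: lookup_tensor lookup_add algebra_simps)

lemma tensor_basis: "tensor (basis a) (basis b) = basis (a, b)"
  by (simp add: tensor_def)

lemma hmult_basis: "hmult A (basis a) (basis b) = mult1 A a b"
  by (simp add: hmult_def tensor_basis)

lemma linear_hmult_left: "Vector_Spaces.linear scale scale (\<lambda>x. hmult A x y)"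
  and linear_hmult_right: "Vector_Spaces.linear scale scale (hmult A x)"
  unfolding hmult_def
  by (rule linear_composition[OF linear_tensor_left lin_ext_linear]
      linear_composition[OF linear_tensor_right lin_ext_linear])+

text \<open>
  The two sides of each axiom are linear in every argument, so the axioms need only be verified on
  the basis.
\<close>

lemma hopf_morphismI:
  assumes lin: "Vector_Spaces.linear scale scale \<Phi>"
    and mult: "\<And>a b. \<Phi> (mult1 A a b) = hmult B (\<Phi> (basis a)) (\<Phi> (basis b))"
    and unit: "\<Phi> (unit1 A) = unit1 B"
    and comult: "\<And>a. hcomult B (\<Phi> (basis a)) = tensor_map \<Phi> \<Phi> (comult1 A a)"
    and counit: "\<And>a. hcounit B (\<Phi> (basis a)) = counit1 A a"
  shows "hopf_morphism A B \<Phi>"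
proof -
  have "\<Phi> (hmult A x (basis b)) = hmult B (\<Phi> x) (\<Phi> (basis b))" for x b
    by (rule linear_eq_on_basis[OF linear_composition[OF linear_hmult_left lin]
          linear_composition[OF lin linear_hmult_left]])
      (simp add: hmult_basis mult)
  then have "\<Phi> (hmult A x y) = hmult B (\<Phi> x) (\<Phi> y)" for x y
    by (rule linear_eq_on_basis[OF linear_composition[OF linear_hmult_right lin]
          linear_composition[OF lin linear_hmult_right]])
  moreover have "hcomult B (\<Phi> x) = tensor_map \<Phi> \<Phi> (hcomult A x)" for x
    unfolding hcomult_def tensor_map_def
    by (rule linear_eq_on_basis[OF linear_composition[OF lin lin_ext_linear]
          linear_composition[OF lin_ext_linear lin_ext_linear]])
      (use comult in \<open>simp add: hcomult_def tensor_map_def\<close>)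
  moreover have "hcounit B (\<Phi> x) = hcounit A x" for x
    unfolding hcounit_def
    by (rule linear_eq_on_basis[OF linear_composition[OF lin form_ext_linear] form_ext_linear])
      (use counit in \<open>simp add: hcounit_def\<close>)
  ultimately show ?thesis
    using lin unit by (simp add: hopf_morphism_def)
qed


section \<open>A morphism to quasi-symmetric functions is determined by its character\<close>

lemma Rep_composition_pos: "0 \<notin> set (Rep_composition u)"
  using Rep_composition[of u] by simp

lemma Rep_Abs_composition [simp]: "0 \<notin> set w \<Longrightarrow> Rep_composition (Abs_composition w) = w"
  by (simp add: Abs_composition_inverse)

lemma eq_Abs_composition_iff:
  "0 \<notin> set w \<Longrightarrow> u = Abs_composition w \<longleftrightarrow> Rep_composition u = w"
  by (metis Rep_Abs_composition Rep_composition_inverse)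

lemma lookup_M:
  "0 \<notin> set v \<Longrightarrow> 0 \<notin> set w \<Longrightarrow>
    Poly_Mapping.lookup (M v) (Abs_composition w) = (if v = w then 1 else 0)"
  by (auto simp: M_def basis_def lookup_single Abs_composition_inject when_def)

lemma hcounit_QSym: "hcounit QSym p = Poly_Mapping.lookup p (Abs_composition [])"
proof -
  have "counit1 QSym = (\<lambda>u. if u = Abs_composition [] then 1 else 0)"
    by (auto simp: QSym_def eq_Abs_composition_iff)
  then show ?thesis
    by (simp add: hcounit_def form_ext_def in_keys_iff if_distrib sum.delta cong: if_cong)
qed

text \<open>
  A word has exactly one cut into \<open>u\<close> followed by \<open>v\<close> if it is \<open>u @ v\<close>, and none otherwise; so the
  coproduct of quasi-symmetric functions loses no information on coefficients.
\<close>

lemma lookup_hcomult_QSym: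
  assumes "0 \<notin> set u" "0 \<notin> set v"
  shows "Poly_Mapping.lookup (hcomult QSym p) (Abs_composition u, Abs_composition v) =
    Poly_Mapping.lookup p (Abs_composition (u @ v))"
proof -
  have coeff: "Poly_Mapping.lookup (comult1 QSym c) (Abs_composition u, Abs_composition v) =
      (if c = Abs_composition (u @ v) then 1 else 0)" for c
  proof -
    let ?w = "Rep_composition c"
    have pos: "0 \<notin> set (take i ?w)" "0 \<notin> set (drop i ?w)" for i
      using Rep_composition_pos[of c] in_set_takeD in_set_dropD by metis+
    have "Poly_Mapping.lookup (comult1 QSym c) (Abs_composition u, Abs_composition v) =
        (\<Sum>i\<le>length ?w. if take i ?w = u \<and> drop i ?w = v then 1 else 0)"
      unfolding QSym_def using assms pos
      by (auto simp: lookup_sum lookup_tensor lookup_M intro!: sum.cong)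
    also have "\<dots> = (\<Sum>i\<le>length ?w. if i = length u then (if ?w = u @ v then 1 else 0) else 0)"
    proof (intro sum.cong refl)
      fix i assume "i \<in> {..length ?w}"
      then have "take i ?w = u \<and> drop i ?w = v \<longleftrightarrow> i = length u \<and> ?w = u @ v"
        by auto
      then show "(if take i ?w = u \<and> drop i ?w = v then 1 else 0) =
          (if i = length u then (if ?w = u @ v then 1 else 0) else (0 :: rat))"
        by simp
    qed
    also have "\<dots> = (if c = Abs_composition (u @ v) then 1 else 0)"
      using assms by (auto simp: eq_Abs_composition_iff)
    finally show ?thesis .
  qed
  show ?thesis
    by (simp add: hcomult_def lookup_lin_ext coeff in_keys_iff if_distrib sum.delta cong: if_cong)
qed

text \<open>
  For \<open>n > 0\<close> the empty word has the wrong degree, which leaves a single word of degree \<open>n\<close> on which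
  the character does not vanish.
\<close>

lemma eps'_QSym_homogeneous:
  assumes "p \<in> homogeneous_part QSym n" "0 < n"
  shows "eps'_QSym p = Poly_Mapping.lookup p (Abs_composition [n])"
proof -
  have "length (Rep_composition u) \<le> 1 \<longleftrightarrow> u = Abs_composition [n]"
    if "u \<in> Poly_Mapping.keys p" for u
  proof -
    have "sum_list (Rep_composition u) = n"
      using assms(1) that by (simp add: homogeneous_part_def QSym_def)
    then show ?thesis
      using \<open>0 < n\<close> by (cases "Rep_composition u") (auto simp: eq_Abs_composition_iff)
  qed
  then have "eps'_QSym p = (\<Sum>u\<in>Poly_Mapping.keys p.
      if u = Abs_composition [n] then Poly_Mapping.lookup p (Abs_composition [n]) else 0)"
    unfolding eps'_QSym_def form_ext_def by (intro sum.cong) auto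
  then show ?thesis
    by (simp add: in_keys_iff)
qed

lemma ABS_morphism_lookup_singleton:
  assumes "is_ABS_morphism A \<alpha> \<Phi>" "0 < n"
  shows "Poly_Mapping.lookup (\<Phi> (basis a)) (Abs_composition [n]) =
    (if degr A a = n then \<alpha> (basis a) else 0)"
proof -
  have "basis a \<in> homogeneous_part A (degr A a)"
    by (simp add: homogeneous_part_def basis_def)
  then have hom: "\<Phi> (basis a) \<in> homogeneous_part QSym (degr A a)"
    using assms(1) unfolding is_ABS_morphism_def homogeneous_map_def by blast
  show ?thesis
  proof (cases "degr A a = n")
    case True
    have "eps'_QSym (\<Phi> (basis a)) = \<alpha> (basis a)"
      using assms(1) by (auto simp: is_ABS_morphism_def)
    with True show ?thesis
      using eps'_QSym_homogeneous[OF hom] assms(2) by simp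
  next
    case False
    with hom assms(2) have "Abs_composition [n] \<notin> Poly_Mapping.keys (\<Phi> (basis a))"
      by (auto simp: homogeneous_part_def QSym_def)
    with False show ?thesis
      by (simp add: in_keys_iff)
  qed
qed

lemma ABS_morphism_lookup_Cons:
  assumes "is_ABS_morphism A \<alpha> \<Phi>" "0 < n" "0 \<notin> set w"
  shows "Poly_Mapping.lookup (\<Phi> (basis a)) (Abs_composition (n # w)) =
    (\<Sum>(b, c)\<in>Poly_Mapping.keys (comult1 A a). Poly_Mapping.lookup (comult1 A a) (b, c) *
      (Poly_Mapping.lookup (\<Phi> (basis b)) (Abs_composition [n]) *
       Poly_Mapping.lookup (\<Phi> (basis c)) (Abs_composition w)))"
proof -
  have comult: "hcomult QSym (\<Phi> (basis a)) = tensor_map \<Phi> \<Phi> (comult1 A a)"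
  proof -
    have "hcomult QSym (\<Phi> (basis a)) = tensor_map \<Phi> \<Phi> (hcomult A (basis a))"
      using assms(1) unfolding is_ABS_morphism_def hopf_morphism_def by blast
    then show ?thesis
      by (simp only: hcomult_def[of A] lin_ext_basis)
  qed
  have "Poly_Mapping.lookup (\<Phi> (basis a)) (Abs_composition (n # w)) =
      Poly_Mapping.lookup (hcomult QSym (\<Phi> (basis a))) (Abs_composition [n], Abs_composition w)"
    using assms(2,3) by (simp add: lookup_hcomult_QSym)
  also have "\<dots> = (\<Sum>p\<in>Poly_Mapping.keys (comult1 A a). Poly_Mapping.lookup (comult1 A a) p *
      (Poly_Mapping.lookup (\<Phi> (basis (fst p))) (Abs_composition [n]) *
       Poly_Mapping.lookup (\<Phi> (basis (snd p))) (Abs_composition w)))"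
    unfolding comult tensor_map_def lookup_lin_ext split_def lookup_tensor ..
  finally show ?thesis
    by (simp only: split_def prod.collapse)
qed

text \<open>
  The two preceding lemmas, together with the counit for the empty word, compute every
  coefficient of \<open>\<Phi> (basis a)\<close> by induction on the word. The basis element must stay arbitrary in
  the induction, since the coproduct of \<open>a\<close> brings in others.
\<close>

lemma ABS_morphism_unique:
  assumes "is_ABS_morphism A \<alpha> \<Phi>" "is_ABS_morphism A \<alpha> \<Psi>"
  shows "\<Phi> = \<Psi>"
proof -
  have lookup_eq: "Poly_Mapping.lookup (\<Phi> (basis a)) (Abs_composition w) =
      Poly_Mapping.lookup (\<Psi> (basis a)) (Abs_composition w)" if "0 \<notin> set w" for a w
    using that
  proof (induction w arbitrary: a)
    case Nil
    have "hcounit QSym (\<Phi> (basis a)) = hcounit QSym (\<Psi> (basis a))"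
      using assms unfolding is_ABS_morphism_def hopf_morphism_def by metis
    then show ?case
      by (simp only: hcounit_QSym)
  next
    case (Cons n w)
    then have n: "0 < n" and w: "0 \<notin> set w" by auto
    show ?case
      unfolding ABS_morphism_lookup_Cons[OF assms(1) n w] ABS_morphism_lookup_Cons[OF assms(2) n w]
        ABS_morphism_lookup_singleton[OF assms(1) n] ABS_morphism_lookup_singleton[OF assms(2) n]
        Cons.IH[OF w] ..
  qed
  have "\<Phi> (basis a) = \<Psi> (basis a)" for a
  proof (rule poly_mapping_eqI)
    show "Poly_Mapping.lookup (\<Phi> (basis a)) u = Poly_Mapping.lookup (\<Psi> (basis a)) u" for u
      using lookup_eq[OF Rep_composition_pos[of u]] by (simp add: Rep_composition_inverse)
  qed
  moreover have "Vector_Spaces.linear scale scale \<Phi>" "Vector_Spaces.linear scale scale \<Psi>"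
    using assms by (simp_all only: is_ABS_morphism_def hopf_morphism_def)
  ultimately show ?thesis
    by (intro ext, elim linear_eq_on_basis)
qed


section \<open>Proper colorings and the product\<close>

text \<open>
  The valid colorings without the condition of being packed; the natural numbers serve as the
  totally ordered set of variables.
\<close>

definition proper_colorings :: "'d dgraph \<Rightarrow> (nat \<Rightarrow> nat) set" where
  "proper_colorings G =
    {f \<in> verts G \<rightarrow>\<^sub>E UNIV. \<forall>x y. {x, y} \<in> edges G \<longrightarrow> f x \<noteq> f y}"

lemma max_color_eq:
  assumes "f ` verts G = {1..k}"
  shows "max_color G f = k"
proof (cases k)
  case (Suc n)
  then show ?thesis
    unfolding max_color_def assms by (intro Max_eqI) auto
qed (use assms in \<open>simp add: max_color_def\<close>)

lemma PVC_iff: "f \<in> PVC G \<longleftrightarrow> f \<in> proper_colorings G \<and> (\<exists>k. f ` verts G = {1..k})"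
proof
  assume "f \<in> proper_colorings G \<and> (\<exists>k. f ` verts G = {1..k})"
  then obtain k where f: "f \<in> proper_colorings G" and k: "f ` verts G = {1..k}" by blast
  have "f x > 0" if "x \<in> verts G" for x
    using that k by (metis atLeastAtMost_iff image_eqI less_eq_Suc_le One_nat_def)
  then show "f \<in> PVC G"
    using f k max_color_eq[OF k] by (auto simp: PVC_def proper_colorings_def PiE_iff)
qed (auto simp: PVC_def proper_colorings_def PiE_iff)

lemma PVC_image: "f \<in> PVC G \<Longrightarrow> f ` verts G = {1..max_color G f}"
  by (simp add: PVC_def)

lemma length_color_word [simp]: "length (color_word wt G f) = max_color G f"
  by (simp add: color_word_def)

lemma nth_color_word: "i < max_color G f \<Longrightarrow> color_word wt G f ! i = color_weight wt G f (Suc i)"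
  by (simp add: color_word_def del: upt_Suc)

definition coloring_monomial :: "('d \<Rightarrow> nat) \<Rightarrow> 'd dgraph \<Rightarrow> (nat \<Rightarrow> nat) \<Rightarrow> (nat \<Rightarrow>\<^sub>0 nat)" where
  "coloring_monomial wt G f = (\<Sum>x\<in>verts G. Poly_Mapping.single (f x) (wt (deco G x)))"

lemma lookup_coloring_monomial:
  "Poly_Mapping.lookup (coloring_monomial wt G f) k = color_weight wt G f k"
  by (simp add: coloring_monomial_def color_weight_def lookup_sum lookup_single when_def
      sum.If_cases Int_def)

lemma color_weight_eq_0_iff:
  assumes "\<And>d. 0 < wt d"
  shows "color_weight wt G f i = 0 \<longleftrightarrow> i \<notin> f ` verts G"
proof -
  have pos: "wt d \<noteq> 0" for d
    using assms[of d] by simp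
  show ?thesis
    by (auto simp: color_weight_def pos)
qed

lemma keys_coloring_monomial:
  assumes "\<And>d. 0 < wt d"
  shows "Poly_Mapping.keys (coloring_monomial wt G f) = f ` verts G"
  by (auto simp: in_keys_iff lookup_coloring_monomial color_weight_eq_0_iff[OF assms])

definition colorings_with_monomial ::
    "('d \<Rightarrow> nat) \<Rightarrow> 'd dgraph \<Rightarrow> (nat \<Rightarrow>\<^sub>0 nat) \<Rightarrow> (nat \<Rightarrow> nat) set" where
  "colorings_with_monomial wt G m = {f \<in> proper_colorings G. coloring_monomial wt G f = m}"

lemma finite_colorings_with_monomial:
  assumes "\<And>d. 0 < wt d"
  shows "finite (colorings_with_monomial wt G m)"
proof (rule finite_subset)
  show "colorings_with_monomial wt G m \<subseteq> verts G \<rightarrow>\<^sub>E Poly_Mapping.keys m"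
  proof
    fix f assume f: "f \<in> colorings_with_monomial wt G m"
    then have "f ` verts G \<subseteq> Poly_Mapping.keys m" "f \<in> extensional (verts G)"
      using keys_coloring_monomial[of wt G f, OF assms]
      by (auto simp: colorings_with_monomial_def proper_colorings_def PiE_iff)
    then show "f \<in> verts G \<rightarrow>\<^sub>E Poly_Mapping.keys m"
      by (auto simp: PiE_iff)
  qed
qed (simp add: finite_PiE)

lemma color_weight_cong:
  assumes "\<And>x. x \<in> verts G \<Longrightarrow> f x = i \<longleftrightarrow> g x = j"
  shows "color_weight wt G f i = color_weight wt G g j"
  unfolding color_weight_def using assms by (intro sum.cong) auto

text \<open>
  The exponents of a monomial \<open>m\<close> in \<open>n\<close> variables form the color word of a packed coloring \<open>g\<close> iff
  \<open>g\<close> becomes a proper coloring with monomial \<open>m\<close> after renaming the color \<open>i\<close> to the \<open>i\<close>-th variable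
  \<open>\<sigma> i\<close> of \<open>m\<close>. Positivity of the weights makes the variables of \<open>m\<close> exactly the colors that are
  used, so that the renaming can be undone by the inverse \<open>\<tau>\<close> of \<open>\<sigma>\<close>.
\<close>

lemma realization_class_chr:
  assumes wt: "\<And>d. 0 < wt d"
  shows "realization (class_chr wt (iso_class G)) m = of_nat (card (colorings_with_monomial wt G m))"
proof -
  define n where "n = card (Poly_Mapping.keys m)"
  (* Colors start at 1, list positions at 0. *)
  define \<sigma> where "\<sigma> i = sorted_list_of_set (Poly_Mapping.keys m) ! (i - 1)" for i
  have exps: "exponents m ! i = Poly_Mapping.lookup m (\<sigma> (Suc i))"
    if "i < n" for i
    using that by (auto simp: exponents_def n_def \<sigma>_def)
  have len: "length (exponents m) = n"
    by (simp add: exponents_def n_def)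
  have \<sigma>: "bij_betw \<sigma> {1..n} (Poly_Mapping.keys m)"
  proof -
    have "bij_betw (\<lambda>i. i - 1) {1..n} {..<n}"
      by (rule bij_betwI[of _ _ _ Suc]) auto
    moreover have "bij_betw ((!) (sorted_list_of_set (Poly_Mapping.keys m))) {..<n}
        (Poly_Mapping.keys m)"
      by (rule bij_betw_nth) (auto simp: n_def)
    ultimately show ?thesis
      unfolding \<sigma>_def[abs_def] by (rule bij_betw_trans[unfolded o_def])
  qed
  define \<tau> where "\<tau> = the_inv_into {1..n} \<sigma>"
  have \<tau>: "bij_betw \<tau> (Poly_Mapping.keys m) {1..n}"
    unfolding \<tau>_def by (rule bij_betw_the_inv_into[OF \<sigma>])
  have \<tau>\<sigma>: "\<tau> (\<sigma> i) = i" if "i \<in> {1..n}" for i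
    using \<sigma> that by (auto simp: \<tau>_def bij_betw_def the_inv_into_f_f)
  have \<sigma>\<tau>: "\<sigma> (\<tau> k) = k" if "k \<in> Poly_Mapping.keys m" for k
    using \<sigma> that by (auto simp: \<tau>_def bij_betw_def f_the_inv_into_f)
  let ?P = "{g \<in> PVC G. color_word wt G g = exponents m}"
  let ?C = "colorings_with_monomial wt G m"
  have P: "g ` verts G = {1..n}" "\<And>i. i \<in> {1..n} \<Longrightarrow> color_weight wt G g i = Poly_Mapping.lookup m (\<sigma> i)"
    if "g \<in> ?P" for g
  proof -
    have n: "max_color G g = n"
      using that len length_color_word[of wt G g] by simp
    then show "g ` verts G = {1..n}"
      using that PVC_image[of g G] by simp
    fix i assume "i \<in> {1..n}"
    then have "i - 1 < n" "Suc (i - 1) = i" by auto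
    then show "color_weight wt G g i = Poly_Mapping.lookup m (\<sigma> i)"
      using that nth_color_word[of "i - 1" G g wt] exps[of "i - 1"] n by simp
  qed
  have C: "f ` verts G = Poly_Mapping.keys m" "\<And>k. color_weight wt G f k = Poly_Mapping.lookup m k"
    if "f \<in> ?C" for f
    using that keys_coloring_monomial[of wt G f, OF wt] lookup_coloring_monomial[of wt G f]
    by (auto simp: colorings_with_monomial_def)
  have "bij_betw (\<lambda>g. restrict (\<sigma> \<circ> g) (verts G)) ?P ?C"
  proof (rule bij_betwI[where g = "\<lambda>f. restrict (\<tau> \<circ> f) (verts G)"])
    show "(\<lambda>g. restrict (\<sigma> \<circ> g) (verts G)) \<in> ?P \<rightarrow> ?C"
    proof
      fix g assume g: "g \<in> ?P"
      let ?f = "restrict (\<sigma> \<circ> g) (verts G)"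
      have in_range: "g x \<in> {1..n}" if "x \<in> verts G" for x
        using P(1)[OF g] that by blast
      have "coloring_monomial wt G ?f = m"
      proof (rule poly_mapping_eqI, unfold lookup_coloring_monomial)
        fix k
        show "color_weight wt G ?f k = Poly_Mapping.lookup m k"
        proof (cases "k \<in> Poly_Mapping.keys m")
          case True
          then have "color_weight wt G ?f k = color_weight wt G g (\<tau> k)"
            using in_range \<tau>\<sigma> \<sigma>\<tau> by (intro color_weight_cong) auto
          then show ?thesis
            using P(2)[OF g, of "\<tau> k"] bij_betwE[OF \<tau>] True \<sigma>\<tau> by simp
        next
          case False
          then have "k \<notin> ?f ` verts G"
            using in_range bij_betwE[OF \<sigma>] by auto
          then show ?thesis
            using False color_weight_eq_0_iff[of wt, OF wt] by (simp add: in_keys_iff)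
        qed
      qed
      moreover have "?f \<in> proper_colorings G"
      proof -
        have "\<sigma> (g x) \<noteq> \<sigma> (g y)" if "{x, y} \<in> edges G" for x y
        proof -
          have "x \<in> verts G" "y \<in> verts G"
            using edge_subset[OF that] by auto
          moreover have "g x \<noteq> g y"
            using g that by (simp add: PVC_def)
          ultimately show ?thesis
            using \<tau>\<sigma>[OF in_range[of x]] \<tau>\<sigma>[OF in_range[of y]] by metis
        qed
        then show ?thesis
          using edge_subset[of _ G] by (fastforce simp: proper_colorings_def)
      qed
      ultimately show "?f \<in> ?C"
        by (simp add: colorings_with_monomial_def)
    qed
    show "(\<lambda>f. restrict (\<tau> \<circ> f) (verts G)) \<in> ?C \<rightarrow> ?P"
    proof
      fix f assume f: "f \<in> ?C"
      let ?g = "restrict (\<tau> \<circ> f) (verts G)"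
      have in_range: "f x \<in> Poly_Mapping.keys m" if "x \<in> verts G" for x
        using C(1)[OF f] that by blast
      have im: "?g ` verts G = {1..n}"
      proof -
        have "?g ` verts G = \<tau> ` f ` verts G"
          by (simp add: image_image)
        then show ?thesis
          using \<tau> by (simp only: C(1)[OF f] bij_betw_def)
      qed
      note n = max_color_eq[OF im]
      have "\<tau> (f x) \<noteq> \<tau> (f y)" if "{x, y} \<in> edges G" for x y
      proof -
        have "x \<in> verts G" "y \<in> verts G"
          using edge_subset[OF that] by auto
        moreover have "f x \<noteq> f y"
          using f that by (simp add: colorings_with_monomial_def proper_colorings_def)
        ultimately show ?thesis
          using \<sigma>\<tau>[OF in_range[of x]] \<sigma>\<tau>[OF in_range[of y]] by metis
      qed
      then have "?g \<in> proper_colorings G"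
        using edge_subset[of _ G] by (fastforce simp: proper_colorings_def)
      moreover have "color_word wt G ?g = exponents m"
      proof (rule nth_equalityI)
        fix i assume "i < length (color_word wt G ?g)"
        then have i: "i < n" by (simp only: length_color_word n)
        have "\<tau> (f x) = Suc i \<longleftrightarrow> f x = \<sigma> (Suc i)" if "x \<in> verts G" for x
          using \<tau>\<sigma>[of "Suc i"] \<sigma>\<tau>[OF in_range[OF that]] i by auto
        then have "color_weight wt G ?g (Suc i) = color_weight wt G f (\<sigma> (Suc i))"
          by (intro color_weight_cong) simp
        then show "color_word wt G ?g ! i = exponents m ! i"
          using i by (simp only: nth_color_word n exps C[OF f])
      qed (simp only: length_color_word n len)
      ultimately show "?g \<in> ?P"
        using im PVC_iff by blast
    qed
  next
    fix g assume g: "g \<in> ?P"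
    then have "g \<in> extensional (verts G)"
      by (auto simp: PVC_def PiE_def)
    moreover have "\<tau> (\<sigma> (g x)) = g x" if "x \<in> verts G" for x
      using P(1)[OF g] \<tau>\<sigma> that by blast
    ultimately show "restrict (\<tau> \<circ> restrict (\<sigma> \<circ> g) (verts G)) (verts G) = g"
      by (intro extensionalityI[of _ "verts G"]) auto
  next
    fix f assume f: "f \<in> ?C"
    then have "f \<in> extensional (verts G)"
      by (auto simp: colorings_with_monomial_def proper_colorings_def PiE_def)
    moreover have "\<sigma> (\<tau> (f x)) = f x" if "x \<in> verts G" for x
      using C(1)[OF f] \<sigma>\<tau> that by blast
    ultimately show "restrict (\<sigma> \<circ> restrict (\<tau> \<circ> f) (verts G)) (verts G) = f"
      by (intro extensionalityI[of _ "verts G"]) auto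
  qed
  then have card: "card ?P = card ?C"
    by (rule bij_betw_same_card)
  have "realization (class_chr wt (iso_class G)) m =
      (\<Sum>g\<in>PVC G. realization (M (color_word wt G g)) m)"
    by (simp add: class_chr.abs_eq realization_def lookup_sum)
  also have "\<dots> = (\<Sum>g\<in>PVC G. if color_word wt G g = exponents m then 1 else 0)"
    using color_word_pos[of wt, OF wt] by (intro sum.cong) (auto simp: realization_M)
  also have "\<dots> = of_nat (card ?P)"
    by (simp add: finite_PVC sum.If_cases Int_def)
  finally show ?thesis
    by (simp only: card)
qed

lemma color_weight_disj_union:
  "color_weight wt (disj_union G H) f i =
    color_weight wt G (\<lambda>x. f (2 * x)) i + color_weight wt H (\<lambda>x. f (Suc (2 * x))) i"
proof -
  let ?w = "\<lambda>x. wt (deco (disj_union G H) x)"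
  have split: "{x \<in> verts (disj_union G H). f x = i} =
      (\<lambda>x. 2 * x) ` {x \<in> verts G. f (2 * x) = i} \<union>
      (\<lambda>x. Suc (2 * x)) ` {x \<in> verts H. f (Suc (2 * x)) = i}" (is "_ = ?A \<union> ?B")
    unfolding verts_disj_union by blast
  have "even x" if "x \<in> ?A" for x
    using that by (elim imageE) simp
  moreover have "odd x" if "x \<in> ?B" for x
    using that by (elim imageE) simp
  ultimately have disjoint: "?A \<inter> ?B = {}" by blast
  have "sum ?w ?A = color_weight wt G (\<lambda>x. f (2 * x)) i"
    by (subst sum.reindex) (simp_all add: inj_on_def color_weight_def)
  moreover have "sum ?w ?B = color_weight wt H (\<lambda>x. f (Suc (2 * x))) i"
    by (subst sum.reindex) (simp_all add: inj_on_def color_weight_def)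
  moreover have "color_weight wt (disj_union G H) f i = sum ?w ?A + sum ?w ?B"
    unfolding color_weight_def split by (rule sum.union_disjoint) (simp_all add: disjoint)
  ultimately show ?thesis by simp
qed

lemma color_weight_restrict [simp]:
  "color_weight wt G (restrict f (verts G)) i = color_weight wt G f i"
  by (rule color_weight_cong) simp

lemma coloring_monomial_disj_union:
  "coloring_monomial wt (disj_union G H) f =
    coloring_monomial wt G (\<lambda>x\<in>verts G. f (2 * x)) +
    coloring_monomial wt H (\<lambda>x\<in>verts H. f (Suc (2 * x)))"
  by (rule poly_mapping_eqI)
    (simp add: lookup_add lookup_coloring_monomial color_weight_disj_union)

lemma proper_colorings_disj_union_iff:
  assumes "f \<in> extensional (verts (disj_union G H))"
  shows "f \<in> proper_colorings (disj_union G H) \<longleftrightarrow>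
    (\<lambda>x\<in>verts G. f (2 * x)) \<in> proper_colorings G \<and>
    (\<lambda>x\<in>verts H. f (Suc (2 * x))) \<in> proper_colorings H" (is "?L \<longleftrightarrow> ?g \<in> _ \<and> ?h \<in> _")
proof
  assume ?L
  then have f: "f x \<noteq> f y" if "{x, y} \<in> edges (disj_union G H)" for x y
    using that by (simp add: proper_colorings_def)
  have "?g x \<noteq> ?g y" if "{x, y} \<in> edges G" for x y
    using that edge_subset[OF that] f[of "2 * x" "2 * y"]
    by (simp add: doubleton_edges_disj_union)
  moreover have "?h x \<noteq> ?h y" if "{x, y} \<in> edges H" for x y
    using that edge_subset[OF that] f[of "Suc (2 * x)" "Suc (2 * y)"]
    by (simp add: doubleton_edges_disj_union)
  ultimately show "?g \<in> proper_colorings G \<and> ?h \<in> proper_colorings H"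
    by (simp add: proper_colorings_def)
next
  assume gh: "?g \<in> proper_colorings G \<and> ?h \<in> proper_colorings H"
  have g: "f (2 * x) \<noteq> f (2 * y)" if "{x, y} \<in> edges G" for x y
    using that gh edge_subset[OF that] by (fastforce simp: proper_colorings_def)
  have h: "f (Suc (2 * x)) \<noteq> f (Suc (2 * y))" if "{x, y} \<in> edges H" for x y
    using that gh edge_subset[OF that] by (fastforce simp: proper_colorings_def)
  have "f x \<noteq> f y" if "{x, y} \<in> edges (disj_union G H)" for x y
  proof -
    have "x \<in> verts (disj_union G H)" "y \<in> verts (disj_union G H)"
      using edge_subset[OF that] by simp_all
    then show ?thesis
      using that g h unfolding verts_disj_union
      by (elim UnE imageE) (simp_all add: doubleton_edges_disj_union)
  qed
  then show ?L
    using assms by (simp add: proper_colorings_def PiE_iff)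
qed

text \<open>
  Restricting a coloring to the two components is a bijection onto pairs of colorings, and the
  monomial of the coloring is the product of the two monomials (written additively).
\<close>

lemma card_colorings_disj_union:
  "card (colorings_with_monomial wt (disj_union G H) m) =
    card (SIGMA p:factorizations m.
      colorings_with_monomial wt G (fst p) \<times> colorings_with_monomial wt H (snd p))"
    (is "card ?A = card ?B")
proof -
  define left where "left f = (\<lambda>x\<in>verts G. f (2 * x))" for f :: "nat \<Rightarrow> nat"
  define right where "right f = (\<lambda>x\<in>verts H. f (Suc (2 * x)))" for f :: "nat \<Rightarrow> nat"
  define merge where "merge g h =
      (\<lambda>x\<in>verts (disj_union G H). if even x then g (x div 2) else h (x div 2))"
    for g h :: "nat \<Rightarrow> nat"
  let ?split = "\<lambda>f. ((coloring_monomial wt G (left f), coloring_monomial wt H (right f)),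
    (left f, right f))"
  have ext: "f \<in> extensional (verts K)" if "f \<in> proper_colorings K" for f and K :: "'a dgraph"
    using that by (auto simp: proper_colorings_def PiE_def)
  have left_merge: "left (merge g h) = g" if "g \<in> proper_colorings G" for g h
    using ext[OF that]
    by (intro extensionalityI[of _ "verts G"]) (simp_all add: left_def merge_def)
  have right_merge: "right (merge g h) = h" if "h \<in> proper_colorings H" for g h
    using ext[OF that]
    by (intro extensionalityI[of _ "verts H"]) (simp_all add: right_def merge_def)
  have merge_left_right: "merge (left f) (right f) = f"
    if "f \<in> proper_colorings (disj_union G H)" for f
  proof (rule extensionalityI[of _ "verts (disj_union G H)"])
    show "merge (left f) (right f) \<in> extensional (verts (disj_union G H))"
      unfolding merge_def by (rule restrict_extensional)
    show "f \<in> extensional (verts (disj_union G H))"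
      by (rule ext[OF that])
    fix x assume "x \<in> verts (disj_union G H)"
    then show "merge (left f) (right f) x = f x"
      unfolding merge_def left_def right_def
      by auto
  qed
  have monomial: "coloring_monomial wt (disj_union G H) f =
      coloring_monomial wt G (left f) + coloring_monomial wt H (right f)" for f
    unfolding left_def right_def by (rule coloring_monomial_disj_union)
  have proper: "f \<in> proper_colorings (disj_union G H) \<longleftrightarrow>
      left f \<in> proper_colorings G \<and> right f \<in> proper_colorings H"
    if "f \<in> extensional (verts (disj_union G H))" for f
    unfolding left_def right_def by (rule proper_colorings_disj_union_iff[OF that])
  have "bij_betw ?split ?A ?B"
  proof (rule bij_betwI[where g = "\<lambda>(_, (g, h)). merge g h"])
    show "?split \<in> ?A \<rightarrow> ?B"
    proof
      fix f assume "f \<in> ?A"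
      then have f: "f \<in> proper_colorings (disj_union G H)"
        and m: "coloring_monomial wt (disj_union G H) f = m"
        by (simp_all only: colorings_with_monomial_def mem_Collect_eq)
      have "left f \<in> proper_colorings G \<and> right f \<in> proper_colorings H"
        using f proper[OF ext[OF f]] by blast
      then show "?split f \<in> ?B"
        using m unfolding colorings_with_monomial_def factorizations_def monomial by simp
    qed
    show "(\<lambda>(_, (g, h)). merge g h) \<in> ?B \<rightarrow> ?A"
    proof
      fix q assume "q \<in> ?B"
      then obtain p g h where q: "q = (p, (g, h))" and p: "p \<in> factorizations m"
        and g: "g \<in> colorings_with_monomial wt G (fst p)"
        and h: "h \<in> colorings_with_monomial wt H (snd p)"
        by blast
      have gh: "g \<in> proper_colorings G" "h \<in> proper_colorings H"
        using g h by (simp_all only: colorings_with_monomial_def mem_Collect_eq)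
      have "merge g h \<in> extensional (verts (disj_union G H))"
        unfolding merge_def by (rule restrict_extensional)
      then have "merge g h \<in> proper_colorings (disj_union G H)"
        using gh by (simp only: proper left_merge right_merge)
      moreover have "coloring_monomial wt (disj_union G H) (merge g h) = m"
        using p g h gh
        by (auto simp: monomial left_merge right_merge colorings_with_monomial_def
            factorizations_def)
      ultimately show "(\<lambda>(_, (g, h)). merge g h) q \<in> ?A"
        unfolding q colorings_with_monomial_def by simp
    qed
  next
    fix f assume "f \<in> ?A"
    then show "(\<lambda>(_, (g, h)). merge g h) (?split f) = f"
      by (simp add: colorings_with_monomial_def merge_left_right)
  next
    fix q assume "q \<in> ?B"
    then obtain p g h where q: "q = (p, (g, h))"
      and g: "g \<in> colorings_with_monomial wt G (fst p)"
      and h: "h \<in> colorings_with_monomial wt H (snd p)"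
      by blast
    then show "?split ((\<lambda>(_, (g, h)). merge g h) q) = q"
      by (simp add: colorings_with_monomial_def left_merge right_merge)
  qed
  then show ?thesis
    by (rule bij_betw_same_card)
qed

text \<open>
  Quasi-symmetric functions may be compared coefficientwise as power series in the variables indexed
  by the natural numbers, where both sides count pairs of proper colorings.
\<close>

lemma class_chr_disj_union:
  assumes wt: "\<And>d. 0 < wt d"
  shows "class_chr wt (iso_class (disj_union G H)) =
    hmult QSym (class_chr wt (iso_class G)) (class_chr wt (iso_class H))"
proof (rule injD[OF inj_realization[OF infinite_UNIV_nat]], rule ext)
  fix m :: "nat \<Rightarrow>\<^sub>0 nat"
  let ?C = "colorings_with_monomial wt"
  have "card (?C (disj_union G H) m) =
      (\<Sum>p\<in>factorizations m. card (?C G (fst p) \<times> ?C H (snd p)))"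
    unfolding card_colorings_disj_union
    by (rule card_SigmaI)
      (blast intro: finite_factorizations finite_cartesian_product
        finite_colorings_with_monomial[of wt, OF wt])+
  then have "rat_of_nat (card (?C (disj_union G H) m)) =
      (\<Sum>p\<in>factorizations m. of_nat (card (?C G (fst p))) * of_nat (card (?C H (snd p))))"
    by (simp only: card_cartesian_product of_nat_sum of_nat_mult)
  also have "\<dots> = realization (hmult QSym (class_chr wt (iso_class G)) (class_chr wt (iso_class H))) m"
    unfolding realization_hmult realization_class_chr[of wt, OF wt] split_def ..
  finally show "realization (class_chr wt (iso_class (disj_union G H))) m =
      realization (hmult QSym (class_chr wt (iso_class G)) (class_chr wt (iso_class H))) m"
    unfolding realization_class_chr[of wt, OF wt] .
qed


section \<open>Cutting a packed coloring and the coproduct\<close>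

lemma color_weight_induced:
  "I \<subseteq> verts G \<Longrightarrow> (\<And>x. x \<in> verts G \<Longrightarrow> g x = j \<and> x \<in> I \<longleftrightarrow> f x = i) \<Longrightarrow>
    color_weight wt (induced G I) g j = color_weight wt G f i"
  unfolding color_weight_def by (intro sum.cong) auto

text \<open>
  Cutting after the color \<open>i\<close>: since \<open>f\<close> takes all values \<open>1, \<dots>, k\<close>, its restriction to the colors
  up to \<open>i\<close> takes the values \<open>1, \<dots>, i\<close>, and the remaining colors shifted down by \<open>i\<close> are
  \<open>1, \<dots>, k - i\<close>. The color classes are kept, which splits the color word.
\<close>

lemma cut_coloring:
  fixes G :: "'d dgraph"
  assumes f: "f \<in> PVC G" and i: "i \<le> max_color G f"
  defines "I \<equiv> {x \<in> verts G. f x \<le> i}"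
  defines "g \<equiv> restrict f I" and "h \<equiv> (\<lambda>x\<in>verts G - I. f x - i)"
  shows "g \<in> PVC (induced G I)" "max_color (induced G I) g = i"
    "color_word wt (induced G I) g = take i (color_word wt G f)"
    "h \<in> PVC (induced G (verts G - I))"
    "color_word wt (induced G (verts G - I)) h = drop i (color_word wt G f)"
proof -
  let ?k = "max_color G f"
  have im: "f ` verts G = {1..?k}" by (rule PVC_image[OF f])
  have proper: "f x \<noteq> f y" if "{x, y} \<in> edges G" for x y
    using f that by (simp add: PVC_def)
  have I: "verts G \<inter> I = I" "verts G \<inter> (verts G - I) = verts G - I"
    by (auto simp: I_def)
  have gim: "g ` verts (induced G I) = {1..i}"
  proof -
    have "g ` verts (induced G I) = f ` verts G \<inter> {..i}"
      unfolding verts_induced I by (auto simp: g_def I_def)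
    then show ?thesis using i unfolding im by auto
  qed
  have him: "h ` verts (induced G (verts G - I)) = {1..?k - i}"
  proof -
    have "h ` verts (induced G (verts G - I)) = (\<lambda>c. c - i) ` (f ` verts G \<inter> {i<..})"
      unfolding verts_induced I by (auto simp: h_def I_def image_iff not_le)
    also have "\<dots> = (\<lambda>c. c - i) ` {Suc i..?k}"
      unfolding im by (intro arg_cong[of _ _ "image _"]) auto
    also have "\<dots> = {1..?k - i}"
      using i by (auto simp: image_iff intro!: bexI[of _ "_ + i"])
    finally show ?thesis .
  qed
  show gmax: "max_color (induced G I) g = i"
    by (rule max_color_eq[OF gim])
  have hmax: "max_color (induced G (verts G - I)) h = ?k - i"
    by (rule max_color_eq[OF him])
  have "g \<in> proper_colorings (induced G I)"
    unfolding proper_colorings_def using proper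
    by (auto simp: g_def I)
  then show "g \<in> PVC (induced G I)"
    using gim PVC_iff by blast
  have "h x \<noteq> h y" if "{x, y} \<in> edges (induced G (verts G - I))" for x y
  proof -
    have "x \<in> verts G - I" "y \<in> verts G - I" "f x \<noteq> f y"
      using that proper by auto
    then show ?thesis
      by (auto simp: h_def I_def)
  qed
  moreover have "h \<in> extensional (verts (induced G (verts G - I)))"
    unfolding verts_induced I h_def by (rule restrict_extensional)
  ultimately have "h \<in> proper_colorings (induced G (verts G - I))"
    by (simp only: proper_colorings_def PiE_iff mem_Collect_eq UNIV_I) blast
  then show "h \<in> PVC (induced G (verts G - I))"
    using him PVC_iff by blast
  show "color_word wt (induced G I) g = take i (color_word wt G f)"
  proof (rule nth_equalityI)
    fix j assume "j < length (color_word wt (induced G I) g)"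
    then have j: "j < i" by (simp add: gmax)
    then have "color_weight wt (induced G I) g (Suc j) = color_weight wt G f (Suc j)"
      by (intro color_weight_induced) (auto simp: g_def I_def)
    then show "color_word wt (induced G I) g ! j = take i (color_word wt G f) ! j"
      using i j by (simp add: nth_color_word gmax)
  qed (use i in \<open>simp add: gmax\<close>)
  show "color_word wt (induced G (verts G - I)) h = drop i (color_word wt G f)"
  proof (rule nth_equalityI)
    fix j assume "j < length (color_word wt (induced G (verts G - I)) h)"
    then have j: "j < ?k - i" by (simp add: hmax)
    have "color_weight wt (induced G (verts G - I)) h (Suc j) = color_weight wt G f (Suc (i + j))"
      by (intro color_weight_induced) (auto simp: h_def I_def)
    then show "color_word wt (induced G (verts G - I)) h ! j = drop i (color_word wt G f) ! j"
      using i j by (simp add: nth_color_word hmax)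
  qed (use i in \<open>simp add: hmax\<close>)
qed

text \<open>
  The inverse of cutting: the colors of the second part are shifted above those of the first, so an
  edge between the two parts is never violated and every edge inside a part was already respected.
\<close>

lemma glue_colorings:
  fixes G :: "'d dgraph"
  assumes I: "I \<subseteq> verts G" and g: "g \<in> PVC (induced G I)" and h: "h \<in> PVC (induced G (verts G - I))"
  defines "i \<equiv> max_color (induced G I) g"
  defines "f \<equiv> (\<lambda>x\<in>verts G. if x \<in> I then g x else h x + i)"
  shows "f \<in> PVC G" "i \<le> max_color G f" "{x \<in> verts G. f x \<le> i} = I"
    "restrict f I = g" "(\<lambda>x\<in>verts G - I. f x - i) = h"
proof -
  let ?k = "max_color (induced G (verts G - I)) h"
  have V: "verts G \<inter> I = I" "verts G \<inter> (verts G - I) = verts G - I"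
    using I by auto
  have gim: "g ` I = {1..i}"
    using PVC_image[OF g] by (simp add: V i_def)
  have him: "h ` (verts G - I) = {1..?k}"
    using PVC_image[OF h] by (simp only: verts_induced V)
  have g_range: "g x \<in> {1..i}" if "x \<in> I" for x
    using gim that by blast
  have h_range: "h x \<in> {1..?k}" if "x \<in> verts G - I" for x
    using him that by blast
  have "f ` verts G = g ` I \<union> (\<lambda>c. c + i) ` h ` (verts G - I)"
    using I by (auto simp: f_def image_iff)
  also have "\<dots> = {1..i} \<union> {1 + i..?k + i}"
    by (simp only: gim him image_add_atLeastAtMost')
  also have "\<dots> = {1..?k + i}" by auto
  finally have im: "f ` verts G = {1..?k + i}" .
  have "f x \<noteq> f y" if xy: "{x, y} \<in> edges G" for x y
  proof -
    have "x \<in> verts G" "y \<in> verts G"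
      using edge_subset[OF xy] by auto
    moreover have "g x \<noteq> g y" if "x \<in> I" "y \<in> I"
      using g xy that by (simp add: PVC_def)
    moreover have "h x \<noteq> h y" if "x \<in> verts G - I" "y \<in> verts G - I"
      using h xy that by (simp add: PVC_def)
    ultimately show ?thesis
      using g_range[of x] g_range[of y] h_range[of x] h_range[of y] by (auto simp: f_def)
  qed
  then have "f \<in> proper_colorings G"
    by (simp add: proper_colorings_def f_def)
  then show "f \<in> PVC G"
    using im PVC_iff by blast
  show "i \<le> max_color G f"
    by (simp add: max_color_eq[OF im])
  show "{x \<in> verts G. f x \<le> i} = I"
    using I g_range h_range by (force simp: f_def)
  have "g \<in> extensional I" "h \<in> extensional (verts G - I)"
    using g h by (auto simp: PVC_def PiE_def V)
  note ext = this
  show "restrict f I = g"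
    using I ext(1) by (intro extensionalityI[of _ I]) (auto simp: f_def)
  show "(\<lambda>x\<in>verts G - I. f x - i) = h"
    using ext(2) by (intro extensionalityI[of _ "verts G - I"]) (auto simp: f_def)
qed

text \<open>
  The common core of both sides of the coproduct axiom, for an arbitrary summand \<open>T\<close> in place of the
  tensor of two basis elements.
\<close>

lemma sum_cuts_eq_sum_pairs:
  fixes T :: "nat list \<Rightarrow> nat list \<Rightarrow> 'c::comm_monoid_add"
  shows "(\<Sum>f\<in>PVC G. \<Sum>i\<le>max_color G f.
      T (take i (color_word wt G f)) (drop i (color_word wt G f))) =
    (\<Sum>I\<in>Pow (verts G). \<Sum>g\<in>PVC (induced G I). \<Sum>h\<in>PVC (induced G (verts G - I)).
      T (color_word wt (induced G I) g) (color_word wt (induced G (verts G - I)) h))"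
proof -
  let ?low = "\<lambda>f i. {x \<in> verts G. f x \<le> i}"
  let ?cut = "\<lambda>(f, i). (?low f i, (restrict f (?low f i), \<lambda>x\<in>verts G - ?low f i. f x - i))"
  let ?glue = "\<lambda>(I, (g, h)). (\<lambda>x\<in>verts G. if x \<in> I then g x else h x + max_color (induced G I) g,
    max_color (induced G I) g)"
  let ?A = "SIGMA f:PVC G. {..max_color G f}"
  let ?B = "SIGMA I:Pow (verts G). PVC (induced G I) \<times> PVC (induced G (verts G - I))"
  have "(\<Sum>(f, i)\<in>?A. T (take i (color_word wt G f)) (drop i (color_word wt G f))) =
    (\<Sum>(I, (g, h))\<in>?B. T (color_word wt (induced G I) g) (color_word wt (induced G (verts G - I)) h))"
  proof (rule sum.reindex_bij_witness[of _ ?glue ?cut])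
    fix p assume "p \<in> ?A"
    then obtain f i where p: "p = (f, i)" and f: "f \<in> PVC G" and i: "i \<le> max_color G f" by auto
    note cut = cut_coloring[OF f i]
    show "?cut p \<in> ?B"
      using cut unfolding p by auto
    show "(case ?cut p of (I, (g, h)) \<Rightarrow>
          T (color_word wt (induced G I) g) (color_word wt (induced G (verts G - I)) h)) =
        (case p of (f, i) \<Rightarrow> T (take i (color_word wt G f)) (drop i (color_word wt G f)))"
      using cut unfolding p by simp
    have "f \<in> extensional (verts G)"
      using f by (simp add: PVC_def PiE_def)
    then show "?glue (?cut p) = p"
      unfolding p prod.case cut(2)
      by (auto intro!: extensionalityI[of _ "verts G"])
  next
    fix q assume "q \<in> ?B"
    then obtain I g h where q: "q = (I, (g, h))" and "I \<subseteq> verts G"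
      "g \<in> PVC (induced G I)" "h \<in> PVC (induced G (verts G - I))" by blast
    note glue = glue_colorings[OF this(2-)]
    show "?glue q \<in> ?A"
      using glue(1,2) unfolding q by simp
    show "?cut (?glue q) = q"
      unfolding q prod.case glue(3,4,5) ..
  qed
  then show ?thesis
    by (simp add: sum.Sigma finite_PVC sum.cartesian_product split_def)
qed

lemma tensor_sum_left: "tensor (\<Sum>i\<in>A. x i) y = (\<Sum>i\<in>A. tensor (x i) y)"
  by (rule linear_map_sum[OF linear_tensor_left])

lemma tensor_sum_right: "tensor x (\<Sum>i\<in>A. y i) = (\<Sum>i\<in>A. tensor x (y i))"
  by (rule linear_map_sum[OF linear_tensor_right])

lemma hcomult_class_chr:
  assumes wt: "\<And>d. 0 < wt d"
  shows "hcomult QSym (class_chr wt (iso_class G)) =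
    tensor_map (F_chr wt) (F_chr wt) (class_comult (iso_class G))"
proof -
  have "hcomult QSym (M (color_word wt G f)) = (\<Sum>i\<le>max_color G f.
      tensor (M (take i (color_word wt G f))) (M (drop i (color_word wt G f))))"
    if "f \<in> PVC G" for f
    using color_word_pos[of wt, OF wt that] by (simp add: hcomult_def M_def QSym_def)
  then have "hcomult QSym (class_chr wt (iso_class G)) = (\<Sum>f\<in>PVC G. \<Sum>i\<le>max_color G f.
      tensor (M (take i (color_word wt G f))) (M (drop i (color_word wt G f))))"
    by (simp add: class_chr.abs_eq hcomult_def linear_map_sum[OF lin_ext_linear])
  also have "\<dots> = (\<Sum>I\<in>Pow (verts G). tensor (class_chr wt (iso_class (induced G I)))
      (class_chr wt (iso_class (induced G (verts G - I)))))"
    unfolding class_chr.abs_eq tensor_sum_left tensor_sum_right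
    by (subst sum_cuts_eq_sum_pairs) (intro sum.cong refl sum.swap)
  also have "\<dots> = tensor_map (F_chr wt) (F_chr wt) (class_comult (iso_class G))"
    by (simp add: class_comult.abs_eq tensor_map_def linear_map_sum[OF lin_ext_linear] F_chr_def)
  finally show ?thesis .
qed


section \<open>Unit, counit, degree and character\<close>

lemma iso_class_eq_empty_iff: "iso_class G = iso_class empty_dgraph \<longleftrightarrow> verts G = {}"
proof -
  have empty: "verts empty_dgraph = {}" "edges empty_dgraph = {}"
    by (transfer; simp)+
  have "dgraph_iso G empty_dgraph \<longleftrightarrow> verts G = {}"
    by (auto simp: dgraph_iso_def dgraph_iso_by_def empty bij_betw_def)
  then show ?thesis
    by (simp add: graph_class.abs_eq_iff)
qed

lemma max_color_eq_0_iff: "f \<in> PVC G \<Longrightarrow> max_color G f = 0 \<longleftrightarrow> verts G = {}"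
  using PVC_image[of f G] by auto

lemma PVC_no_verts: "verts G = {} \<Longrightarrow> PVC G = {\<lambda>_. undefined}"
  using edge_subset[of _ G] edge_card[of _ G]
  by (fastforce simp: PVC_iff proper_colorings_def intro!: exI[of _ 0])

lemma class_chr_empty:
  fixes wt :: "'d \<Rightarrow> nat"
  shows "class_chr wt (iso_class empty_dgraph) = M []"
proof -
  have "verts (empty_dgraph :: 'd dgraph) = {}"
    using iso_class_eq_empty_iff by blast
  then show ?thesis
    by (simp add: class_chr.abs_eq PVC_no_verts color_word_def max_color_def)
qed

lemma hcounit_class_chr:
  assumes wt: "\<And>d. 0 < wt d"
  shows "hcounit QSym (class_chr wt (iso_class G)) = (if verts G = {} then 1 else 0)"
proof -
  have "hcounit QSym (class_chr wt (iso_class G)) =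
      (\<Sum>f\<in>PVC G. Poly_Mapping.lookup (M (color_word wt G f)) (Abs_composition []))"
    by (simp add: hcounit_QSym class_chr.abs_eq lookup_sum)
  also have "\<dots> = (\<Sum>f\<in>PVC G. if verts G = {} then 1 else 0)"
    using color_word_pos[of wt, OF wt] max_color_eq_0_iff[of _ G]
    by (intro sum.cong) (auto simp: lookup_M simp flip: length_0_conv)
  also have "\<dots> = (if verts G = {} then 1 else 0)"
    by (simp add: PVC_no_verts)
  finally show ?thesis .
qed

text \<open>
  The color classes partition the vertices.
\<close>

lemma sum_list_color_word:
  assumes "f \<in> PVC G"
  shows "sum_list (color_word wt G f) = weight wt G"
proof -
  have "sum_list (color_word wt G f) = (\<Sum>i\<in>f ` verts G. color_weight wt G f i)"
    unfolding PVC_image[OF assms] color_word_def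
    by (simp only: interv_sum_list_conv_sum_set_nat set_upt atLeastLessThanSuc_atLeastAtMost)
  also have "\<dots> = weight wt G"
    unfolding color_weight_def weight_def by (rule sum.group) auto
  finally show ?thesis .
qed

lemma class_chr_homogeneous:
  assumes wt: "\<And>d. 0 < wt d"
  shows "class_chr wt (iso_class G) \<in> homogeneous_part QSym (weight wt G)"
proof -
  have "sum_list (Rep_composition u) = weight wt G"
    if "u \<in> Poly_Mapping.keys (class_chr wt (iso_class G))" for u
  proof -
    have "(\<Sum>f\<in>PVC G. Poly_Mapping.lookup (M (color_word wt G f)) u) \<noteq> 0"
      using that by (simp add: class_chr.abs_eq in_keys_iff lookup_sum)
    then obtain f where f: "f \<in> PVC G" and "Poly_Mapping.lookup (M (color_word wt G f)) u \<noteq> 0"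
      by (rule sum.not_neutral_contains_not_neutral)
    then have "u = Abs_composition (color_word wt G f)"
      by (auto simp: M_def basis_def lookup_single when_def split: if_splits)
    then show ?thesis
      using color_word_pos[of wt, OF wt f] by (simp add: sum_list_color_word[OF f])
  qed
  then show ?thesis
    by (simp add: homogeneous_part_def QSym_def)
qed

lemma keys_lin_ext_subset:
  "Poly_Mapping.keys (lin_ext f x) \<subseteq> (\<Union>a\<in>Poly_Mapping.keys x. Poly_Mapping.keys (f a))"
proof
  fix b assume "b \<in> Poly_Mapping.keys (lin_ext f x)"
  then have "(\<Sum>a\<in>Poly_Mapping.keys x. Poly_Mapping.lookup x a * Poly_Mapping.lookup (f a) b) \<noteq> 0"
    by (simp add: in_keys_iff lookup_lin_ext)
  then obtain a where "a \<in> Poly_Mapping.keys x"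
    "Poly_Mapping.lookup x a * Poly_Mapping.lookup (f a) b \<noteq> 0"
    by (rule sum.not_neutral_contains_not_neutral)
  then show "b \<in> (\<Union>a\<in>Poly_Mapping.keys x. Poly_Mapping.keys (f a))"
    by (auto simp: in_keys_iff)
qed

lemma F_chr_homogeneous:
  assumes wt: "\<And>d. 0 < wt d"
  shows "homogeneous_map (graph_hopf wt) QSym (F_chr wt)"
  unfolding homogeneous_map_def
proof (intro allI subsetI, elim imageE)
  fix n y x
  assume x: "x \<in> homogeneous_part (graph_hopf wt) n" and y: "y = F_chr wt x"
  have hom: "class_chr wt c \<in> homogeneous_part QSym (class_weight wt c)" for c
    using class_chr_homogeneous[of wt, OF wt]
    by (induction c rule: graph_class.abs_induct) (simp add: class_weight.abs_eq)
  show "y \<in> homogeneous_part QSym n"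
    unfolding homogeneous_part_def
  proof (safe)
    fix u assume "u \<in> Poly_Mapping.keys y"
    then obtain c where "c \<in> Poly_Mapping.keys x" "u \<in> Poly_Mapping.keys (class_chr wt c)"
      using keys_lin_ext_subset[of "class_chr wt" x] unfolding y F_chr_def by blast
    then show "degr QSym u = n"
      using hom[of c] x by (simp add: homogeneous_part_def graph_hopf_def)
  qed
qed

text \<open>
  With at most one color the coloring is constantly 1, which an edge forbids. The empty graph is
  included: its only coloring uses no color at all.
\<close>

lemma PVC_at_most_one_color:
  "{f \<in> PVC G. max_color G f \<le> 1} = (if edges G = {} then {\<lambda>x\<in>verts G. 1} else {})"
proof -
  have one: "f = (\<lambda>x\<in>verts G. 1) \<and> edges G = {}" if f: "f \<in> PVC G" "max_color G f \<le> 1" for f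
  proof
    have f1: "f x = 1" if "x \<in> verts G" for x
    proof -
      have "f x \<in> {1..max_color G f}"
        using that PVC_image[OF f(1)] by blast
      then show ?thesis using f(2) by simp
    qed
    have "f \<in> extensional (verts G)"
      using f by (simp add: PVC_def PiE_def)
    then show "f = (\<lambda>x\<in>verts G. 1)"
      using f1 by (intro extensionalityI[of _ "verts G"]) auto
    show "edges G = {}"
    proof (rule ccontr)
      assume "edges G \<noteq> {}"
      then obtain e where e: "e \<in> edges G" by blast
      then obtain x y where xy: "e = {x, y}"
        using edge_card[OF e] unfolding card_2_iff by blast
      then have "f x = f y"
        using f1 edge_subset[OF e] by simp
      then show False
        using f(1) e xy by (simp add: PVC_def)
    qed
  qed
  have "(\<lambda>x\<in>verts G. 1) \<in> PVC G \<and> max_color G (\<lambda>x\<in>verts G. 1) \<le> 1" if "edges G = {}"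
  proof -
    have im: "(\<lambda>x\<in>verts G. 1 :: nat) ` verts G = {1..(if verts G = {} then 0 else 1)}"
      by (cases "verts G = {}") auto
    have "(\<lambda>x\<in>verts G. 1) \<in> proper_colorings G"
      using that by (simp add: proper_colorings_def)
    then have "(\<lambda>x\<in>verts G. 1) \<in> PVC G"
      using im PVC_iff by blast
    moreover have "max_color G (\<lambda>x\<in>verts G. 1) \<le> 1"
      unfolding max_color_eq[OF im] by simp
    ultimately show ?thesis ..
  qed
  then show ?thesis
    using one by (cases "edges G = {}") auto
qed

lemma eps'_QSym_class_chr:
  assumes wt: "\<And>d. 0 < wt d"
  shows "eps'_QSym (class_chr wt (iso_class G)) = (if edges G = {} then 1 else 0)"
proof -
  have "eps'_QSym (class_chr wt (iso_class G)) = (\<Sum>f\<in>PVC G. eps'_QSym (M (color_word wt G f)))"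
    by (simp add: class_chr.abs_eq eps'_QSym_def linear_map_sum[OF form_ext_linear])
  also have "\<dots> = (\<Sum>f\<in>PVC G. if max_color G f \<le> 1 then 1 else 0)"
    using color_word_pos[of wt, OF wt] by (intro sum.cong) (simp_all add: eps'_QSym_def M_def)
  also have "\<dots> = of_nat (card {f \<in> PVC G. max_color G f \<le> 1})"
    by (simp add: finite_PVC sum.If_cases Int_def)
  finally show ?thesis
    unfolding PVC_at_most_one_color by simp
qed

lemma F_chr_hopf_morphism:
  assumes wt: "\<And>d. 0 < wt d"
  shows "hopf_morphism (graph_hopf wt) QSym (F_chr wt)"
proof (rule hopf_morphismI)
  show "Vector_Spaces.linear scale scale (F_chr wt)"
    unfolding F_chr_def by (rule lin_ext_linear)
  show "F_chr wt (mult1 (graph_hopf wt) a b) = hmult QSym (F_chr wt (basis a)) (F_chr wt (basis b))"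
    for a b
    using class_chr_disj_union[of wt, OF wt]
    by (induction a rule: graph_class.abs_induct, induction b rule: graph_class.abs_induct)
      (simp add: F_chr_def graph_hopf_def class_union.abs_eq)
  show "F_chr wt (unit1 (graph_hopf wt)) = unit1 QSym"
    by (simp add: F_chr_def graph_hopf_def QSym_def class_chr_empty)
  show "hcomult QSym (F_chr wt (basis a)) =
      tensor_map (F_chr wt) (F_chr wt) (comult1 (graph_hopf wt) a)" for a
    using hcomult_class_chr[of wt, OF wt]
    by (induction a rule: graph_class.abs_induct) (simp add: F_chr_def graph_hopf_def)
  show "hcounit QSym (F_chr wt (basis a)) = counit1 (graph_hopf wt) a" for a
    using hcounit_class_chr[of wt, OF wt]
    by (induction a rule: graph_class.abs_induct)
      (simp add: F_chr_def graph_hopf_def iso_class_eq_empty_iff)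
qed

lemma F_chr_is_ABS_morphism:
  assumes wt: "\<And>d. 0 < wt d"
  shows "is_ABS_morphism (graph_hopf wt) eps'_graph (F_chr wt)"
proof -
  have "eps'_QSym (F_chr wt (basis a)) = eps'_graph (basis a)" for a
    using eps'_QSym_class_chr[of wt, OF wt]
    by (induction a rule: graph_class.abs_induct)
      (simp add: F_chr_def eps'_graph_def class_edgeless.abs_eq)
  then have "eps'_QSym (F_chr wt x) = eps'_graph x" for x
    unfolding eps'_QSym_def eps'_graph_def F_chr_def
    by (rule linear_eq_on_basis[OF linear_composition[OF lin_ext_linear form_ext_linear]
          form_ext_linear])
  then show ?thesis
    using F_chr_hopf_morphism[of wt, OF wt] F_chr_homogeneous[of wt, OF wt]
    by (auto simp: is_ABS_morphism_def)
qed

theorem proposition3p5: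
  fixes wt :: "'d \<Rightarrow> nat"
  assumes "\<And>d. 0 < wt d"
  shows "hopf_morphism (graph_hopf wt) QSym (F_chr wt) \<and>
    (\<exists>!\<Phi>. is_ABS_morphism (graph_hopf wt) eps'_graph \<Phi>) \<and>
    F_chr wt = ABS_morphism (graph_hopf wt) eps'_graph"
proof (intro conjI)
  show "hopf_morphism (graph_hopf wt) QSym (F_chr wt)"
    by (rule F_chr_hopf_morphism[OF assms])
  have F: "is_ABS_morphism (graph_hopf wt) eps'_graph (F_chr wt)"
    by (rule F_chr_is_ABS_morphism[OF assms])
  then show "\<exists>!\<Phi>. is_ABS_morphism (graph_hopf wt) eps'_graph \<Phi>"
    using ABS_morphism_unique by blast
  show "F_chr wt = ABS_morphism (graph_hopf wt) eps'_graph"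
    unfolding ABS_morphism_def
  proof (rule the_equality[symmetric])
    show "is_ABS_morphism (graph_hopf wt) eps'_graph (F_chr wt)"
      by (rule F)
  qed (rule ABS_morphism_unique[OF _ F])
qed

end
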